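(* The first integral homology group $H_1(\mathcal{G}(\mathbb{R}\times\mathbb{Z});\mathbb{Z})$ of the space $\mathcal{G}(\mathbb{R}\times\mathbb{Z})$ of closed subgroups of $\mathbb{R}\times\mathbb{Z}$ is uncountable, and therefore the fundamental group of $\mathcal{G}(\mathbb{R}\times\mathbb{Z})$ is uncountable as well.
   Context: For a locally compact topological group $G$, $\mathcal{G}(G)$ is the set of closed subgroups of $G$ with the Chabauty topology: the open sets are the arbitrary unions of finite intersections of sets of the form $O_K=\{H: H\cap K=\emptyset\}$ ($K\subset G$ compact) and $O'_U=\{H: H\cap U\neq\emptyset\}$ ($U\subset G$ open). $\mathbb{R}\times\mathbb{Z}$ carries the product topology. Homology is singular homology. *)

theory Defs
  imports "HOL-Homology.Homology"
begin

text \<open>The Chabauty space of a group \<open>G\<close> endowed with a (locally compact group) topology \<open>T\<close>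
  on its carrier.\<close>

definition closed_subgroups :: "('a, 'b) monoid_scheme \<Rightarrow> 'a topology \<Rightarrow> 'a set set"
  where "closed_subgroups G T = {H. subgroup H G \<and> closedin T H}"

definition chabauty_topology :: "('a, 'b) monoid_scheme \<Rightarrow> 'a topology \<Rightarrow> 'a set topology"
  where "chabauty_topology G T =
    topology_generated_by
      ({{H \<in> closed_subgroups G T. H \<inter> K = {}} | K. compactin T K} \<union>
       {{H \<in> closed_subgroups G T. H \<inter> U \<noteq> {}} | U. openin T U})"

lemma topspace_chabauty_topology [simp]:
  "topspace (chabauty_topology G T) = closed_subgroups G T"
proof
  let ?B = "{{H \<in> closed_subgroups G T. H \<inter> K = {}} | K. compactin T K}"
  let ?C = "{{H \<in> closed_subgroups G T. H \<inter> U \<noteq> {}} | U. openin T U}"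
  have "S \<subseteq> closed_subgroups G T" if "S \<in> ?B \<union> ?C" for S
    using that by auto
  then show "topspace (chabauty_topology G T) \<subseteq> closed_subgroups G T"
    unfolding chabauty_topology_def topology_generated_by_topspace by (rule Union_least)
  have "closed_subgroups G T \<in> ?B"
    by (rule CollectI, rule exI[of _ "{}"]) simp
  then have "closed_subgroups G T \<in> ?B \<union> ?C"
    by (rule UnI1)
  then show "closed_subgroups G T \<subseteq> topspace (chabauty_topology G T)"
    unfolding chabauty_topology_def topology_generated_by_topspace by (rule Union_upper)
qed

definition real_group :: "real monoid"
  where "real_group = \<lparr>carrier = UNIV, monoid.mult = (+), one = 0\<rparr>"

definition chabauty_R_Z :: "(real \<times> int) set topology"
  where "chabauty_R_Z =
    chabauty_topology (real_group \<times>\<times> integer_group)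
      (prod_topology euclideanreal (discrete_topology UNIV))"

text \<open>The fundamental group of an abstract topology. Loops are functions on all of \<open>real\<close>, but
  their values outside \<open>{0..1}\<close> do not affect \<^const>\<open>homotopic_with\<close>, so each
  class below is an ordinary homotopy class of loops relative to the end points.\<close>

definition loops_at :: "'a topology \<Rightarrow> 'a \<Rightarrow> (real \<Rightarrow> 'a) set"
  where "loops_at X a = {p. pathin X p \<and> p 0 = a \<and> p 1 = a}"

definition loop_homotopy :: "'a topology \<Rightarrow> 'a \<Rightarrow> ((real \<Rightarrow> 'a) \<times> (real \<Rightarrow> 'a)) set"
  where "loop_homotopy X a =
    {(p, q). p \<in> loops_at X a \<and> q \<in> loops_at X a \<and>
       homotopic_with (\<lambda>r. r 0 = a \<and> r 1 = a) (top_of_set {0..1}) X p q}"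

text \<open>\<^const>\<open>joinpaths\<close> is only available for types in class \<open>topological_space\<close>.\<close>

definition loop_join :: "(real \<Rightarrow> 'a) \<Rightarrow> (real \<Rightarrow> 'a) \<Rightarrow> real \<Rightarrow> 'a"
  where "loop_join p q = (\<lambda>t. if t \<le> 1/2 then p (2 * t) else q (2 * t - 1))"

definition fundamental_group :: "'a topology \<Rightarrow> 'a \<Rightarrow> (real \<Rightarrow> 'a) set monoid"
  where "fundamental_group X a =
    \<lparr>carrier = loops_at X a // loop_homotopy X a,
     monoid.mult = (\<lambda>A B. \<Union>p\<in>A. \<Union>q\<in>B. loop_homotopy X a `` {loop_join p q}),
     one = loop_homotopy X a `` {\<lambda>_. a}\<rparr>"

lemma equiv_loop_homotopy: "equiv (loops_at X a) (loop_homotopy X a)"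
proof (rule equivI)
  show "loop_homotopy X a \<subseteq> loops_at X a \<times> loops_at X a"
    by (auto simp: loop_homotopy_def)
  show "refl_on (loops_at X a) (loop_homotopy X a)"
    by (auto simp: refl_on_def loop_homotopy_def loops_at_def pathin_def)
  show "sym (loop_homotopy X a)"
    by (auto simp: sym_def loop_homotopy_def homotopic_with_sym)
  show "trans (loop_homotopy X a)"
    by (auto simp: trans_def loop_homotopy_def intro: homotopic_with_trans)
qed

end

theory Submission
  imports Defs "HOL-Analysis.Abstract_Metric_Spaces" "HOL-Analysis.Further_Topology"
    "HOL-Computational_Algebra.Primes"
begin

text \<open>Some closed subgroups of \<open>\<real> \<times> \<int>\<close> form a Hawaiian earring: for \<open>n \<ge> 1\<close> the groups generated by
  \<open>(x, n)\<close> with \<open>x \<in> \<real>\<close> form a line, both ends of which converge to the trivial group, and these lines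
  shrink to the trivial group as \<open>n\<close> tends to infinity. So for every set \<open>E\<close> of odd primes there is
  a loop, \<open>earring_loop E\<close>, that runs once through each line with index in \<open>E\<close>. The question is why
  these uncountably many loops do not become equivalent in the whole space.

  The other subgroups that reach level \<open>n\<close> fill a disc: they are generated by \<open>(a, 0)\<close> and \<open>(x, n)\<close>, have
  polar coordinates \<open>a\<close> and \<open>x\<close> modulo \<open>a\<close>, and the centre of the disc is \<open>\<real> \<times> n\<int>\<close>. For \<open>a \<rightarrow> \<infinity>\<close> the
  disc is attached to all lines whose index is a multiple of \<open>n\<close>, so each disc kills a combination
  of circles. A finite chain or a homotopy can however pass through only finitely many
  centres: near a limit of centres, the levels met by a subgroup of short horizontal period are locally constant,
  and a connected piece meeting two coprime levels would meet level 1 (\<open>finite_punctures\<close>).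

  For an odd prime \<open>p\<close> there is a continuous nonzero complex function on the complement of the single point
  \<open>\<real> \<times> p\<int>\<close> that detects the line with index \<open>p\<close> (\<open>continuous_winding_fun\<close>,
  \<open>winding_fun_earring_loop\<close>). Position on level \<open>n\<close>, modulo the horizontal period and with value \<open>-1\<close>
  if the level is not met, gives a circle-valued function away from the degenerate groups; for short
  periods it is a character of the level, so that the function of level \<open>p\<close> divided by the \<open>p\<close>-th power of the one of
  level \<open>1\<close> is constant near all the centres except that of the disc \<open>p\<close>.

  Consequently, if the loops for \<open>E\<close> and \<open>E'\<close> are homologous, or homotopic after transport to some
  base point, then for all but finitely many \<open>p\<close> their images under the \<open>p\<close>-th function have the same winding number, that is,
  \<open>E\<close> and \<open>E'\<close> differ by finitely many primes (\<open>homologous_earring_loops\<close>,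
  \<open>homotopic_earring_loops\<close>). Both groups therefore are uncountable. For the fundamental group at an
  arbitrary base point it remains to join every subgroup to the trivial one
  (\<open>path_to_trivial\<close>).\<close>

section \<open>The Chabauty space of \<open>\<real> \<times> \<int>\<close>\<close>

lemma prod_topology_real_int:
  "prod_topology euclideanreal (discrete_topology UNIV) = (euclidean :: (real \<times> int) topology)"
proof -
  have "discrete_topology UNIV = (euclidean :: int topology)"
    by (simp add: topology_eq open_discrete)
  then show ?thesis by simp
qed

lemma group_real_group: "group real_group"
proof -
  have "\<exists>y. y + x = 0" for x :: real
    by (rule exI[of _ "- x"]) simp
  then show ?thesis
    unfolding real_group_def by (intro groupI) auto
qed

lemma subgroup_real_int_iff:
  "subgroup H (real_group \<times>\<times> integer_group) \<longleftrightarrow>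
    (0, 0) \<in> H \<and> (\<forall>x m y n. (x, m) \<in> H \<longrightarrow> (y, n) \<in> H \<longrightarrow> (x - y, m - n) \<in> H)"
  (is "?lhs \<longleftrightarrow> ?rhs")
proof -
  let ?G = "real_group \<times>\<times> integer_group"
  interpret G: group ?G
    by (simp add: DirProd_group group_real_group)
  have carr: "carrier ?G = UNIV" and one: "\<one>\<^bsub>?G\<^esub> = (0, 0)"
    and mult: "(x, m) \<otimes>\<^bsub>?G\<^esub> (y, n) = (x + y, m + n)" for x y m n
    by (auto simp: real_group_def integer_group_def DirProd_def)
  have inv: "inv\<^bsub>?G\<^esub> (x, m) = (- x, - m)" for x m
    by (rule G.inv_equality) (simp_all add: real_group_def integer_group_def)
  show ?thesis
  proof
    assume H: ?lhs
    have "(x - y, m - n) \<in> H" if "(x, m) \<in> H" "(y, n) \<in> H" for x y m n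
      using subgroup.m_closed[OF H that(1) subgroup.m_inv_closed[OF H that(2)]]
      unfolding inv mult by simp
    then show ?rhs
      using subgroup.one_closed[OF H, unfolded one] by blast
  next
    assume H: ?rhs
    have neg: "(- x, - m) \<in> H" if "(x, m) \<in> H" for x m
      using H that by (metis diff_0)
    have add: "(x + y, m + n) \<in> H" if "(x, m) \<in> H" "(y, n) \<in> H" for x m y n
      using H neg[OF that(2)] that(1) by (metis diff_minus_eq_add)
    show ?lhs
    proof (rule subgroup.intro)
      show "p \<otimes>\<^bsub>?G\<^esub> q \<in> H" if "p \<in> H" "q \<in> H" for p q
        using add[of "fst p" "snd p" "fst q" "snd q"] mult[of "fst p" "snd p" "fst q" "snd q"] that
        by (simp only: prod.collapse)
      show "inv\<^bsub>?G\<^esub> p \<in> H" if "p \<in> H" for p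
        using neg[of "fst p" "snd p"] inv[of "fst p" "snd p"] that
        by (simp only: prod.collapse)
    qed (use H in \<open>simp_all only: carr one subset_UNIV\<close>)
  qed
qed

lemma topspace_chabauty_iff:
  "H \<in> topspace chabauty_R_Z \<longleftrightarrow> closed H \<and> (0, 0) \<in> H \<and>
    (\<forall>x m y n. (x, m) \<in> H \<longrightarrow> (y, n) \<in> H \<longrightarrow> (x - y, m - n) \<in> H)"
  unfolding chabauty_R_Z_def prod_topology_real_int
  by (auto simp: closed_subgroups_def subgroup_real_int_iff)

context
  fixes H assumes H: "H \<in> topspace chabauty_R_Z"
begin

lemma closed_subgroupD: "closed H"
  and zero_in_subgroup: "(0, 0) \<in> H"
  and diff_in_subgroup: "(x, m) \<in> H \<Longrightarrow> (y, n) \<in> H \<Longrightarrow> (x - y, m - n) \<in> H"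
  using H by (auto simp: topspace_chabauty_iff)

lemma neg_in_subgroup: "(x, m) \<in> H \<Longrightarrow> (- x, - m) \<in> H"
  using diff_in_subgroup[OF zero_in_subgroup] by simp

lemma add_in_subgroup: "(x, m) \<in> H \<Longrightarrow> (y, n) \<in> H \<Longrightarrow> (x + y, m + n) \<in> H"
  using diff_in_subgroup[of x m "- y" "- n"] neg_in_subgroup by simp

lemma scale_in_subgroup:
  assumes "(x, m) \<in> H" shows "(of_int k * x, k * m) \<in> H"
proof -
  have *: "(of_nat j * x, int j * m) \<in> H" for j
    by (induction j) (use assms zero_in_subgroup in \<open>auto simp: algebra_simps intro: add_in_subgroup\<close>)
  show ?thesis
  proof (cases "k \<ge> 0")
    case True
    then show ?thesis using *[of "nat k"] by simp
  next
    case False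
    then show ?thesis using neg_in_subgroup[OF *[of "nat (- k)"]] by simp
  qed
qed

end

lemma openin_chabauty_avoid:
  assumes "compact K"
  shows "openin chabauty_R_Z {H \<in> topspace chabauty_R_Z. H \<inter> K = {}}"
  using assms unfolding chabauty_R_Z_def topspace_chabauty_topology prod_topology_real_int
  unfolding chabauty_topology_def
  by (intro topology_generated_by_Basis) auto

lemma openin_chabauty_hit:
  assumes "open U"
  shows "openin chabauty_R_Z {H \<in> topspace chabauty_R_Z. H \<inter> U \<noteq> {}}"
  using assms unfolding chabauty_R_Z_def topspace_chabauty_topology prod_topology_real_int
  unfolding chabauty_topology_def
  by (intro topology_generated_by_Basis) auto

lemma open_level: "open A \<Longrightarrow> open (A \<times> {n :: int})" for A :: "real set"
  by (simp add: open_Times open_discrete)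

lemma compact_level: "compact A \<Longrightarrow> compact (A \<times> {n :: int})" for A :: "real set"
  by (simp add: compact_Times)

lemma closed_levelsI:
  fixes G :: "('a::topological_space \<times> int) set"
  assumes "\<And>n. closed {a. (a, n) \<in> G}"
  shows "closed G"
proof -
  have "open ((- {a. (a, n) \<in> G}) \<times> {n})" for n
    using assms[of n] by (intro open_Times) (auto simp: open_discrete)
  then have "open (\<Union>n. (- {a. (a, n) \<in> G}) \<times> {n})"
    by blast
  moreover have "(\<Union>n. (- {a. (a, n) \<in> G}) \<times> {n}) = - G"
    by auto
  ultimately show ?thesis by (simp add: closed_def)
qed

text \<open>The two kinds of subbasic sets are handled separately. Parameters whose subgroup meets a
  compact \<open>K\<close> form a closed set, namely the projection of a compact piece of the closed graph; the
  condition of meeting an open set is open because every point of a member of the family is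
  approached by points of the nearby members.\<close>

lemma continuous_map_chabautyI:
  fixes F :: "'b::t2_space \<Rightarrow> (real \<times> int) set"
  assumes S: "compact S"
    and zero: "\<And>s. s \<in> S \<Longrightarrow> (0, 0) \<in> F s"
    and diff: "\<And>s x m y n. s \<in> S \<Longrightarrow> (x, m) \<in> F s \<Longrightarrow> (y, n) \<in> F s \<Longrightarrow> (x - y, m - n) \<in> F s"
    and graph: "\<And>n. closed {(s, x). s \<in> S \<and> (x, n) \<in> F s}"
    and lower: "\<And>s x n. s \<in> S \<Longrightarrow> (x, n) \<in> F s \<Longrightarrow>
      \<exists>g. (g \<longlongrightarrow> x) (at s within S) \<and> (\<forall>\<^sub>F r in at s within S. (g r, n) \<in> F r)"
  shows "continuous_map (top_of_set S) chabauty_R_Z F"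
proof -
  have hit: "openin (top_of_set S) {s \<in> S. F s \<inter> U \<noteq> {}}" if "open U" for U
  proof (subst openin_subopen, intro ballI)
    fix s assume "s \<in> {s \<in> S. F s \<inter> U \<noteq> {}}"
    then obtain x n where s: "s \<in> S" and x: "(x, n) \<in> F s" "(x, n) \<in> U"
      by auto
    obtain g where g: "(g \<longlongrightarrow> x) (at s within S)" "\<forall>\<^sub>F r in at s within S. (g r, n) \<in> F r"
      using lower[OF s x(1)] by blast
    have "((\<lambda>r. (g r, n)) \<longlongrightarrow> (x, n)) (at s within S)"
      by (intro tendsto_intros g(1))
    then have "\<forall>\<^sub>F r in at s within S. (g r, n) \<in> U"
      using \<open>open U\<close> x(2) by (rule topological_tendstoD)
    with g(2) have "\<forall>\<^sub>F r in at s within S. F r \<inter> U \<noteq> {}"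
      by eventually_elim auto
    then obtain T where T: "open T" "s \<in> T" "\<And>r. r \<in> T \<Longrightarrow> r \<noteq> s \<Longrightarrow> r \<in> S \<Longrightarrow> F r \<inter> U \<noteq> {}"
      unfolding eventually_at_topological by blast
    have "S \<inter> T \<subseteq> {s \<in> S. F s \<inter> U \<noteq> {}}"
      using T x by blast
    then show "\<exists>T. openin (top_of_set S) T \<and> s \<in> T \<and> T \<subseteq> {s \<in> S. F s \<inter> U \<noteq> {}}"
      using T s by (intro exI[of _ "S \<inter> T"]) (auto simp: openin_open_Int)
  qed
  have avoid: "openin (top_of_set S) {s \<in> S. F s \<inter> K = {}}" if "compact K" for K
  proof -
    define G where "G = {(s, x, n). s \<in> S \<and> (x, n) \<in> F s}"
    have "G = (\<lambda>(s, x, n). ((s, x), n)) -` {((s, x), n). s \<in> S \<and> (x, n) \<in> F s}"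
      by (auto simp: G_def)
    moreover have "closed {((s, x), n). s \<in> S \<and> (x, n) \<in> F s}"
      by (rule closed_levelsI) (use graph in \<open>simp add: case_prod_unfold\<close>)
    moreover have "continuous_on UNIV (\<lambda>(s, x, n). ((s, x), n) :: ('b \<times> real) \<times> int)"
      unfolding case_prod_unfold by (intro continuous_intros)
    ultimately have "closed G"
      by (simp only: closed_vimage)
    then have "compact ((S \<times> K) \<inter> G)"
      using S \<open>compact K\<close> by (intro compact_Int_closed compact_Times)
    then have "closed (fst ` ((S \<times> K) \<inter> G))"
      by (intro compact_imp_closed compact_continuous_image continuous_intros)
    moreover have "{s \<in> S. F s \<inter> K = {}} = S - fst ` ((S \<times> K) \<inter> G)"
      by (force simp: G_def)
    ultimately show ?thesis
      by (metis Diff_eq open_Compl openin_open_Int)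
  qed
  have F: "F s \<in> topspace chabauty_R_Z" if "s \<in> S" for s
  proof -
    have "{x. (x, n) \<in> F s} = Pair s -` {(s, x). s \<in> S \<and> (x, n) \<in> F s}" for n
      using that by auto
    moreover have "closed (Pair s -` {(s, x). s \<in> S \<and> (x, n) \<in> F s})" for n
      by (intro closed_vimage graph continuous_intros)
    ultimately have "closed {x. (x, n) \<in> F s}" for n
      by simp
    then have "closed (F s)" by (rule closed_levelsI)
    then show ?thesis using that zero diff by (simp add: topspace_chabauty_iff)
  qed
  have image: "F ` S \<subseteq> topspace chabauty_R_Z"
    using F by blast
  have "F ` S \<subseteq> closed_subgroups (real_group \<times>\<times> integer_group)
      (prod_topology euclideanreal (discrete_topology UNIV))"
    using F by (auto simp: chabauty_R_Z_def)
  then have eq: "F -` {H \<in> closed_subgroups (real_group \<times>\<times> integer_group) euclidean. P H} \<inter> S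
      = {s \<in> S. P (F s)}" for P
    by (auto simp: prod_topology_real_int)
  show ?thesis
    unfolding chabauty_R_Z_def chabauty_topology_def prod_topology_real_int
  proof (rule continuous_on_generated_topo, goal_cases)
    case (1 V)
    then consider K where "compact K"
        "V = {H \<in> closed_subgroups (real_group \<times>\<times> integer_group) euclidean. H \<inter> K = {}}"
      | U where "open U"
        "V = {H \<in> closed_subgroups (real_group \<times>\<times> integer_group) euclidean. H \<inter> U \<noteq> {}}"
      by auto
    then show ?case
    proof cases
      case 1
      then show ?thesis
        unfolding topspace_euclidean_subtopology 1(2) eq by (intro avoid)
    next
      case 2
      then show ?thesis
        unfolding topspace_euclidean_subtopology 2(2) eq by (intro hit)
    qed
  next
    case 2
    show ?case
      using image unfolding chabauty_R_Z_def chabauty_topology_def prod_topology_real_int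
        topology_generated_by_topspace topspace_euclidean_subtopology .
  qed
qed

section \<open>The horizontal period\<close>

text \<open>The remaining closed subgroups contain the whole line \<open>\<real> \<times> {0}\<close>, hence are the groups
  \<open>\<real> \<times> n\<int>\<close>: the limits in which the horizontal period tends to \<open>0\<close>.\<close>

definition non_degenerate :: "(real \<times> int) set set"
  where "non_degenerate = {H \<in> topspace chabauty_R_Z. \<exists>x. (x, 0) \<notin> H}"

text \<open>The value \<open>0\<close> stands for an infinite period, so that the frequency is continuous also
  where the horizontal part degenerates to \<open>{0}\<close>. The factor \<open>\<pi>\<close> makes multiples of the period
  change \<open>y * freq H\<close> by multiples of \<open>\<pi>\<close>, which sine and cosine see only as a sign.\<close>

definition freq :: "(real \<times> int) set \<Rightarrow> real"
  where "freq H = (if \<exists>x>0. (x, 0) \<in> H then pi / Inf {x. x > 0 \<and> (x, 0) \<in> H} else 0)"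

lemma non_degenerateD: "H \<in> non_degenerate \<Longrightarrow> H \<in> topspace chabauty_R_Z"
  by (simp add: non_degenerate_def)

lemma closed_slice:
  assumes "H \<in> topspace chabauty_R_Z" shows "closed {x. (x, n) \<in> H}"
proof -
  have "closed ((\<lambda>x. (x, n)) -` H)"
    by (intro closed_vimage closed_subgroupD[OF assms] continuous_intros)
  then show ?thesis by (simp add: vimage_def)
qed

lemma floor_multiple:
  fixes x z :: real assumes "x > 0"
  shows "0 \<le> z - of_int \<lfloor>z / x\<rfloor> * x" "z - of_int \<lfloor>z / x\<rfloor> * x < x"
proof -
  show "0 \<le> z - of_int \<lfloor>z / x\<rfloor> * x"
    using assms floor_divide_lower[of x z] by simp
  show "z - of_int \<lfloor>z / x\<rfloor> * x < x"
    using assms floor_divide_upper[of x z] by (simp add: algebra_simps)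
qed

text \<open>Arbitrarily small periods would have multiples close to every real, which closedness
  excludes as soon as one horizontal point is missing.\<close>

lemma period_minimal:
  assumes H: "H \<in> non_degenerate" and x: "x > 0" "(x, 0) \<in> H"
  defines "a \<equiv> Inf {x. x > 0 \<and> (x, 0) \<in> H}"
  shows "a > 0" "(a, 0) \<in> H" "\<And>y. (y, 0) \<in> H \<Longrightarrow> \<exists>k::int. y = of_int k * a"
proof -
  let ?S = "{x. x > 0 \<and> (x, 0) \<in> H}"
  have HX: "H \<in> topspace chabauty_R_Z" using H by (rule non_degenerateD)
  have mult: "(y - of_int k * u, 0) \<in> H" if "(y, 0) \<in> H" "(u, 0) \<in> H" for y u and k :: int
    using diff_in_subgroup[OF HX that(1) scale_in_subgroup[OF HX that(2), of k]] by simp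
  obtain z where z: "(z, 0) \<notin> H"
    using H by (auto simp: non_degenerate_def)
  then have "z \<in> - {x. (x, 0) \<in> H}" by simp
  then obtain d where d: "d > 0" "ball z d \<subseteq> - {x. (x, 0) \<in> H}"
    using closed_slice[OF HX] unfolding closed_def by (meson openE)
  have lb: "d \<le> u" if "u \<in> ?S" for u
  proof (rule ccontr)
    assume "\<not> d \<le> u"
    then have "dist z (of_int \<lfloor>z / u\<rfloor> * u) < d"
      using floor_multiple[of u z] that by (simp add: dist_real_def)
    then have "(of_int \<lfloor>z / u\<rfloor> * u, 0) \<notin> H"
      using d(2) by (auto simp: subset_iff)
    then show False
      using scale_in_subgroup[OF HX, of u 0 "\<lfloor>z / u\<rfloor>"] that by simp
  qed
  have "?S = {d..} \<inter> {x. (x, 0) \<in> H}"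
    using lb d(1) by force
  then have "closed ?S"
    using closed_slice[OF HX] by (metis closed_Int closed_atLeast)
  moreover have bdd: "bdd_below ?S"
    using lb by (intro bdd_belowI)
  moreover have "?S \<noteq> {}" using x by auto
  ultimately have "a \<in> ?S"
    unfolding a_def by (intro closed_contains_Inf)
  then show a: "a > 0" "(a, 0) \<in> H" by auto
  show "\<exists>k::int. y = of_int k * a" if "(y, 0) \<in> H" for y
  proof (rule exI[of _ "\<lfloor>y / a\<rfloor>"], rule ccontr)
    assume "y \<noteq> of_int \<lfloor>y / a\<rfloor> * a"
    then have "y - of_int \<lfloor>y / a\<rfloor> * a \<in> ?S"
      using floor_multiple(1)[OF a(1), of y] mult[OF that a(2)] by simp
    then have "a \<le> y - of_int \<lfloor>y / a\<rfloor> * a"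
      unfolding a_def by (rule cInf_lower[OF _ bdd])
    then show False
      using floor_multiple(2)[OF a(1), of y] by simp
  qed
qed

lemma freq_nonneg: "H \<in> non_degenerate \<Longrightarrow> freq H \<ge> 0"
  using period_minimal(1)[of H] by (auto simp: freq_def less_imp_le)

lemma freq_period:
  assumes "H \<in> non_degenerate" "freq H > 0" shows "(pi / freq H, 0) \<in> H"
  using assms period_minimal(2)[of H] by (auto simp: freq_def split: if_splits)

lemma freq_pos:
  assumes "H \<in> non_degenerate" "(x, 0) \<in> H" "x \<noteq> 0" shows "freq H > 0"
proof -
  have "(- x, 0) \<in> H"
    using neg_in_subgroup[OF non_degenerateD assms(2)] assms(1) by simp
  then have "\<exists>x>0. (x, 0) \<in> H"
    using assms(2,3) by (metis linorder_neqE_linordered_idom neg_0_less_iff_less)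
  then show ?thesis
    using period_minimal(1)[OF assms(1)] by (auto simp: freq_def)
qed

lemma freq_multiple:
  assumes H: "H \<in> non_degenerate" and x: "(x, 0) \<in> H"
  obtains k :: int where "x * freq H = of_int k * pi"
proof (cases "x = 0")
  case True
  then show ?thesis using that[of 0] by simp
next
  case False
  then have "freq H > 0" using freq_pos[OF H x] by simp
  then have ex: "\<exists>x>0. (x, 0) \<in> H"
    by (auto simp: freq_def split: if_splits)
  then obtain x0 where x0: "x0 > 0" "(x0, 0) \<in> H" by blast
  obtain k :: int where "x = of_int k * Inf {x. x > 0 \<and> (x, 0) \<in> H}"
    using period_minimal(3)[OF H x0 x] by blast
  then show ?thesis
    using that[of k] period_minimal(1)[OF H x0] ex by (simp add: freq_def)
qed

lemma freq_ge:
  assumes H: "H \<in> non_degenerate" and x: "(x, 0) \<in> H" "x > 0"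
  shows "pi \<le> x * freq H"
proof -
  obtain k :: int where k: "x * freq H = of_int k * pi"
    using freq_multiple[OF H x(1)] by blast
  have "x * freq H > 0" using freq_pos[OF H x(1)] x(2) by simp
  then have "k \<ge> 1" by (simp add: k zero_less_mult_iff)
  then show ?thesis by (simp add: k)
qed

text \<open>A period shorter than the length of a gap would have a multiple inside the gap.\<close>

lemma freq_avoid:
  assumes H: "H \<in> non_degenerate" and a: "0 < a" "2 * a \<le> b"
    and avoid: "H \<inter> {a..b} \<times> {0} = {}"
  shows "b * freq H < pi"
proof (cases "freq H > 0")
  case True
  define p where "p = pi / freq H"
  have p: "p > 0" "(p, 0) \<in> H"
    using True freq_period[OF H True] by (simp_all add: p_def)
  have "p > b"
  proof (rule ccontr)
    assume "\<not> p > b"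
    with avoid p(2) have "p < a" by force
    moreover define k where "k = \<lfloor>(2 * a) / p\<rfloor>"
    ultimately have "of_int k * p \<in> {a..b}"
      using floor_multiple[OF p(1), of "2 * a"] a by (auto simp: k_def)
    moreover have "(of_int k * p, 0) \<in> H"
      using scale_in_subgroup[OF non_degenerateD[OF H] p(2), of k] by simp
    ultimately show False using avoid by blast
  qed
  then show ?thesis using True by (simp add: p_def field_simps)
next
  case False
  then have "freq H = 0" using freq_nonneg[OF H] by simp
  then show ?thesis by simp
qed

text \<open>Being near \<open>H0\<close> means to have a point near its period and none in a window below it; by
  \<open>freq_avoid\<close> such a window excludes all shorter periods once it is longer than its distance from \<open>0\<close>.\<close>

lemma freq_continuous_at:
  assumes H0: "H0 \<in> non_degenerate" and e: "e > 0"
  obtains U where "openin chabauty_R_Z U" "H0 \<in> U"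
    "\<And>H. H \<in> U \<Longrightarrow> H \<in> non_degenerate \<and> \<bar>freq H - freq H0\<bar> < e"
proof (cases "freq H0 > 0")
  case True
  define p where "p = pi / freq H0"
  have p: "p > 0" "(p, 0) \<in> H0" "freq H0 = pi / p"
    using True freq_period[OF H0 True] by (simp_all add: p_def)
  have "isCont (\<lambda>x. pi / x) p"
    using p by (intro continuous_intros) auto
  then obtain d where d: "d > 0" "\<And>x. \<bar>x - p\<bar> < d \<Longrightarrow> \<bar>pi / x - pi / p\<bar> < e"
    using e unfolding continuous_at_eps_delta dist_real_def by metis
  define r where "r = min (d / 2) (p / 4)"
  have r: "r > 0" "r < d" "r \<le> p / 4"
    using d p by (auto simp: r_def)
  define U where "U = {H \<in> topspace chabauty_R_Z. H \<inter> {p - r<..<p + r} \<times> {0} \<noteq> {}} \<inter>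
    {H \<in> topspace chabauty_R_Z. H \<inter> {p / 3..p - r} \<times> {0} = {}}"
  show ?thesis
  proof
    show "openin chabauty_R_Z U"
      unfolding U_def
      by (intro openin_Int openin_chabauty_avoid openin_chabauty_hit open_level compact_level) auto
    have "(x, 0) \<notin> H0" if "p / 3 \<le> x" "x \<le> p - r" for x
    proof
      assume "(x, 0) \<in> H0"
      then have "pi \<le> x * freq H0"
        using freq_ge[OF H0] that p(1) by simp
      then have "p \<le> x" using p by (simp add: field_simps)
      then show False using that r by simp
    qed
    moreover have "(p, 0) \<in> H0 \<inter> {p - r<..<p + r} \<times> {0}"
      using p r by simp
    ultimately show "H0 \<in> U"
      using non_degenerateD[OF H0] unfolding U_def by (auto simp del: Int_iff)
    fix H assume "H \<in> U"
    then have HX: "H \<in> topspace chabauty_R_Z" and avoid: "H \<inter> {p / 3..p - r} \<times> {0} = {}"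
      and hit: "H \<inter> {p - r<..<p + r} \<times> {0} \<noteq> {}"
      by (auto simp: U_def)
    obtain x where x: "(x, 0) \<in> H" "p - r < x" "x < p + r" using hit by auto
    have "(p / 3, 0) \<notin> H" using avoid p r by force
    then have H: "H \<in> non_degenerate" using HX by (auto simp: non_degenerate_def)
    have x0: "x > 0" using x p r by simp
    have pos: "freq H > 0" using freq_pos[OF H x(1)] x0 by simp
    define q where "q = pi / freq H"
    have q: "q > 0" "freq H = pi / q" using pos by (auto simp: q_def)
    have "q \<le> x"
      using freq_ge[OF H x(1) x0] q by (simp add: field_simps)
    moreover have "(p - r) * freq H < pi"
      using freq_avoid[OF H _ _ avoid] p r by simp
    then have "(p - r) * freq H < q * freq H"
      using pos by (simp add: q_def)
    then have "p - r < q"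
      using pos by simp
    ultimately have "\<bar>q - p\<bar> < d" using x r by linarith
    then show "H \<in> non_degenerate \<and> \<bar>freq H - freq H0\<bar> < e"
      using H d(2)[of q] q p by simp
  qed
next
  case False
  then have freq0: "freq H0 = 0" using freq_nonneg[OF H0] by simp
  define M where "M = 2 + pi / e"
  have M: "M \<ge> 2" using e by (simp add: M_def)
  define U where "U = {H \<in> topspace chabauty_R_Z. H \<inter> {1..M} \<times> {0} = {}}"
  show ?thesis
  proof
    show "openin chabauty_R_Z U"
      unfolding U_def by (intro openin_chabauty_avoid compact_level) auto
    show "H0 \<in> U"
      using freq_pos[OF H0] freq0 non_degenerateD[OF H0] by (force simp: U_def)
    fix H assume "H \<in> U"
    then have HX: "H \<in> topspace chabauty_R_Z" and avoid: "H \<inter> {1..M} \<times> {0} = {}"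
      by (auto simp: U_def)
    have "(1, 0) \<notin> H" using avoid M by force
    then have H: "H \<in> non_degenerate" using HX by (auto simp: non_degenerate_def)
    have "M * freq H < pi" using freq_avoid[OF H _ _ avoid] M by simp
    moreover have "(pi / e) * freq H \<le> M * freq H"
      using freq_nonneg[OF H] by (intro mult_right_mono) (simp_all add: M_def)
    ultimately have "pi / e * freq H < pi" by linarith
    then have "freq H < e" using e by (simp add: field_simps)
    then show "H \<in> non_degenerate \<and> \<bar>freq H - freq H0\<bar> < e"
      using H freq_nonneg[OF H] freq0 by simp
  qed
qed

lemma openin_non_degenerate: "openin chabauty_R_Z non_degenerate"
proof (subst openin_subopen, intro ballI)
  fix H assume "H \<in> non_degenerate"
  then show "\<exists>T. openin chabauty_R_Z T \<and> H \<in> T \<and> T \<subseteq> non_degenerate"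
    using freq_continuous_at[of H 1] by (metis subsetI zero_less_one)
qed

section \<open>The phase of a level\<close>

definition sinc :: "real \<Rightarrow> real"
  where "sinc x = (if x = 0 then 1 else sin x / x)"

lemma sinc_mult: "sinc x * x = sin x"
  by (simp add: sinc_def)

lemma continuous_sinc: "continuous_on UNIV sinc"
proof -
  have "isCont sinc x" for x
  proof (cases "x = 0")
    case True
    have "((\<lambda>h. sin h / h) \<longlongrightarrow> (1::real)) (at 0)"
      using DERIV_sin[of "0::real"] by (simp add: DERIV_def)
    then have "(sinc \<longlongrightarrow> 1) (at 0)"
      by (rule Lim_transform_eventually) (auto simp: sinc_def eventually_at_filter)
    then show ?thesis using True by (simp add: isCont_def sinc_def)
  next
    case False
    have "isCont (\<lambda>x. sin x / x) x" using False by (intro continuous_intros) auto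
    moreover have "\<forall>\<^sub>F y in nhds x. sinc y = sin y / y"
      using t1_space_nhds[OF False] by eventually_elim (simp add: sinc_def)
    ultimately show ?thesis by (simp add: isCont_cong)
  qed
  then show ?thesis by (simp add: continuous_on_eq_continuous_at)
qed

lemma cos_le_sinc:
  assumes "\<bar>x\<bar> \<le> pi / 2" shows "\<bar>cos x\<bar> \<le> \<bar>sinc x\<bar>"
proof -
  have *: "y * cos y \<le> sin y" if "0 \<le> y" "y \<le> pi / 2" for y :: real
  proof -
    have "(\<lambda>y. sin y - y * cos y) 0 \<le> (\<lambda>y. sin y - y * cos y) y"
    proof (rule DERIV_nonneg_imp_nondecreasing[OF that(1)])
      fix z :: real assume z: "0 \<le> z" "z \<le> y"
      have "((\<lambda>y. sin y - y * cos y) has_real_derivative z * sin z) (at z)"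
        by (auto intro!: derivative_eq_intros)
      moreover have "z * sin z \<ge> 0"
        using z that by (intro mult_nonneg_nonneg sin_ge_zero) auto
      ultimately show "\<exists>D. ((\<lambda>y. sin y - y * cos y) has_real_derivative D) (at z) \<and> 0 \<le> D"
        by blast
    qed
    then show ?thesis by simp
  qed
  show ?thesis
  proof (cases "x = 0")
    case False
    have "0 \<le> cos x" using assms by (intro cos_ge_zero) auto
    moreover have "\<bar>sin x\<bar> = sin \<bar>x\<bar>"
      using sin_ge_zero[of "\<bar>x\<bar>"] assms pi_gt_zero by (cases "x \<ge> 0") (auto simp: abs_if)
    ultimately have "\<bar>x\<bar> * \<bar>cos x\<bar> \<le> \<bar>sin x\<bar>"
      using *[of "\<bar>x\<bar>"] assms by simp
    then show ?thesis using False by (simp add: sinc_def field_simps abs_divide)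
  qed (simp add: sinc_def)
qed

text \<open>With \<open>w = tan (y * t) / t\<close>, read as \<open>y\<close> at \<open>t = 0\<close> and scaled by \<open>max 1 t\<close>, the phase below is the
  Cayley transform \<open>(1 + \<i> w) / (1 - \<i> w)\<close>. It is well defined on the circle of circumference \<open>\<pi> / t\<close>, and as
  \<open>t\<close> tends to \<open>0\<close> it becomes the standard map from the line onto the circle minus the point \<open>-1\<close>. The
  scaling turns it into the exact character \<open>cis (2 * (y * t))\<close> for \<open>t \<ge> 1\<close>. Numerator and denominator are
  kept multiplied by \<open>cos (y * t)\<close> to avoid the poles of the tangent.\<close>

definition phase_den :: "real \<Rightarrow> real \<Rightarrow> complex"
  where "phase_den y t = Complex (cos (y * t)) (- (y * sinc (y * t) * max 1 t))"

definition phase :: "real \<Rightarrow> real \<Rightarrow> complex"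
  where "phase y t = cnj (phase_den y t) / phase_den y t"

lemma phase_den_nonzero: "phase_den y t \<noteq> 0"
proof
  assume "phase_den y t = 0"
  then have c: "cos (y * t) = 0" and s: "y * sinc (y * t) * max 1 t = 0"
    by (simp_all add: phase_den_def complex_eq_iff)
  have "max 1 t > 0" by simp
  then have "y * sinc (y * t) = 0" using s by (metis less_irrefl mult_eq_0_iff)
  then have "sinc (y * t) * (y * t) = 0" by auto
  then have "sin (y * t) = 0" by (simp add: sinc_mult)
  then show False using c by (metis sin_zero_abs_cos_one abs_zero zero_neq_one)
qed

lemma phase_nonzero: "phase y t \<noteq> 0"
  by (simp add: phase_def phase_den_nonzero)

lemma continuous_phase: "continuous_on UNIV (\<lambda>(y, t). phase y t)"
proof -
  have "continuous_on UNIV (\<lambda>z. sinc (fst z * snd z) :: real)"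
    by (intro continuous_on_compose2[OF continuous_sinc] continuous_intros) auto
  then have "continuous_on UNIV (\<lambda>z. phase_den (fst z) (snd z))"
    unfolding phase_den_def by (intro continuous_intros)
  then show ?thesis
    unfolding phase_def case_prod_beta
    by (intro continuous_intros) (auto simp: phase_den_nonzero)
qed

text \<open>Both numerator and denominator of the phase change by the same sign under translation by a
  period.\<close>

lemma phase_add_period:
  assumes x: "x * t = of_int k * pi" and t0: "t = 0 \<Longrightarrow> x = 0"
  shows "phase (y + x) t = phase y t"
proof (cases "t = 0")
  case False
  have u: "y * sinc (y * t) = sin (y * t) / t" for y
    using sinc_mult[of "y * t"] False by (simp add: field_simps)
  have arg: "(y + x) * t = y * t + of_int k * pi"
    using x by (simp add: algebra_simps)
  obtain s :: real where s: "s \<noteq> 0" "cos (y * t + of_int k * pi) = s * cos (y * t)"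
      "sin (y * t + of_int k * pi) = s * sin (y * t)"
  proof
    show "cos (of_int k * pi) \<noteq> (0::real)"
      by (metis sin_zero_abs_cos_one sin_int_times_real abs_zero zero_neq_one mult.commute sin_integer_2pi sin_zero_iff_int2)
  qed (simp_all add: cos_add sin_add sin_zero_iff_int2)
  have "(y + x) * sinc ((y + x) * t) = s * (y * sinc (y * t))"
    unfolding u by (simp add: arg s)
  then have "phase_den (y + x) t = of_real s * phase_den y t"
    unfolding phase_den_def by (simp add: arg s complex_eq_iff)
  then show ?thesis using s(1) by (simp add: phase_def)
qed (use t0 in simp)

lemma phase_high_freq:
  assumes "t \<ge> 1" shows "phase y t = cis (2 * (y * t))"
proof -
  have "y * sinc (y * t) * max 1 t = sin (y * t)"
    using assms sinc_mult[of "y * t"] by (simp add: max_def algebra_simps)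
  then have "phase_den y t = cis (- (y * t))"
    by (simp add: phase_den_def complex_eq_iff)
  then have "phase y t = cis (y * t - - (y * t))"
    by (simp only: phase_def cis_cnj cis_divide minus_minus)
  also have "y * t - - (y * t) = 2 * (y * t)" by simp
  finally show ?thesis .
qed

text \<open>This is what makes the value \<open>-1\<close> the right one when a level escapes to infinity, uniformly
  in the period; the estimate \<open>\<bar>tan x\<bar> \<ge> \<bar>x\<bar>\<close> is behind it.\<close>

lemma phase_near_minus_one:
  assumes "\<bar>y * t\<bar> \<le> pi / 2" "y \<noteq> 0"
  shows "norm (phase y t + 1) \<le> 2 / \<bar>y\<bar>"
proof -
  let ?d = "phase_den y t"
  have "phase y t + 1 = (cnj ?d + ?d) / ?d"
    using phase_den_nonzero[of y t] by (simp add: phase_def field_simps)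
  also have "cnj ?d + ?d = of_real (2 * cos (y * t))"
    by (simp add: phase_den_def complex_eq_iff)
  finally have eq: "norm (phase y t + 1) = 2 * \<bar>cos (y * t)\<bar> / norm ?d"
    by (simp add: norm_divide abs_mult)
  have "\<bar>y\<bar> * \<bar>cos (y * t)\<bar> \<le> \<bar>y\<bar> * \<bar>sinc (y * t)\<bar> * 1"
    using cos_le_sinc[OF assms(1)] by (simp add: mult_left_mono)
  also have "\<dots> \<le> \<bar>y\<bar> * \<bar>sinc (y * t)\<bar> * max 1 t"
    by (intro mult_left_mono) auto
  also have "\<dots> = \<bar>Im ?d\<bar>" by (simp add: phase_den_def abs_mult)
  also have "\<dots> \<le> norm ?d" by (rule abs_Im_le_cmod)
  finally have "2 * \<bar>cos (y * t)\<bar> \<le> 2 / \<bar>y\<bar> * norm ?d"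
    using assms(2) by (simp add: field_simps)
  then show ?thesis
    unfolding eq using phase_den_nonzero[of y t] by (simp add: divide_le_eq)
qed

lemma phase_zero_freq: "phase (cos a / sin a) 0 = - cis (- 2 * a)" if "sin a \<noteq> 0"
proof -
  have "phase_den (cos a / sin a) 0 = of_real (1 / sin a) * (- \<i> * cis a)"
    using that by (simp add: phase_den_def sinc_def complex_eq_iff)
  then show ?thesis
    using that by (simp add: phase_def cis_cnj cis_divide)
qed

definition level_phase :: "int \<Rightarrow> (real \<times> int) set \<Rightarrow> complex"
  where "level_phase n H =
    (if \<exists>y. (y, n) \<in> H then phase (SOME y. (y, n) \<in> H) (freq H) else - 1)"

lemma level_phase_empty: "(\<And>y. (y, n) \<notin> H) \<Longrightarrow> level_phase n H = - 1"
  by (simp add: level_phase_def)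

lemma level_phase_eq:
  assumes H: "H \<in> non_degenerate" and y: "(y, n) \<in> H"
  shows "level_phase n H = phase y (freq H)"
proof -
  define z where "z = (SOME y. (y, n) \<in> H)"
  have z: "(z, n) \<in> H" unfolding z_def using y by (rule someI)
  have x: "(z - y, 0) \<in> H"
    using diff_in_subgroup[OF non_degenerateD[OF H] z y] by simp
  obtain k :: int where "(z - y) * freq H = of_int k * pi"
    using freq_multiple[OF H x] by blast
  moreover have "z - y = 0" if "freq H = 0"
    using freq_pos[OF H x] that by auto
  ultimately have "phase (y + (z - y)) (freq H) = phase y (freq H)"
    by (rule phase_add_period)
  then show ?thesis using y by (auto simp: level_phase_def z_def)
qed

lemma level_phase_nonzero: "level_phase n H \<noteq> 0"
  by (simp add: level_phase_def phase_nonzero)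

lemma small_representative:
  assumes H: "H \<in> non_degenerate" and y: "(y, n) \<in> H"
  obtains z where "(z, n) \<in> H" "\<bar>z * freq H\<bar> \<le> pi / 2"
proof (cases "freq H > 0")
  case True
  define p where "p = pi / freq H"
  have p: "p > 0" "(p, 0) \<in> H" "freq H = pi / p"
    using True freq_period[OF H True] by (simp_all add: p_def)
  define z where "z = y - of_int \<lfloor>(y + p / 2) / p\<rfloor> * p"
  have "(z, n) \<in> H"
    using diff_in_subgroup[OF non_degenerateD[OF H] y scale_in_subgroup[OF non_degenerateD[OF H] p(2)]]
    by (simp add: z_def)
  moreover have "\<bar>z\<bar> \<le> p / 2"
    using floor_multiple[OF p(1), of "y + p / 2"] unfolding z_def by linarith
  then have "\<bar>z * freq H\<bar> \<le> pi / 2"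
    using p(1) by (simp add: p(3) abs_mult field_simps)
  ultimately show ?thesis by (rule that)
next
  case False
  then show ?thesis using freq_nonneg[OF H] that[OF y] by simp
qed

text \<open>If the level is met, nearby subgroups meet it nearby and the joint continuity of the phase
  applies. If not, nearby subgroups miss a long interval of the level, and all representatives
  are so large that the phase is close to \<open>-1\<close>.\<close>

lemma level_phase_continuous_at:
  assumes H0: "H0 \<in> non_degenerate" and e: "e > 0"
  obtains U where "openin chabauty_R_Z U" "H0 \<in> U"
    "\<And>H. H \<in> U \<Longrightarrow> H \<in> non_degenerate \<and> dist (level_phase n H) (level_phase n H0) < e"
proof (cases "\<exists>y. (y, n) \<in> H0")
  case True
  then obtain y0 where y0: "(y0, n) \<in> H0" by blast
  let ?t = "freq H0"
  have "isCont (\<lambda>(y, t). phase y t) (y0, ?t)"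
    using continuous_phase by (simp add: continuous_on_eq_continuous_at)
  then obtain d where d: "d > 0"
      "\<And>y t. dist (y, t) (y0, ?t) < d \<Longrightarrow> dist (phase y t) (phase y0 ?t) < e"
    using e unfolding continuous_at_eps_delta by (auto simp: split_paired_all)
  obtain U where U: "openin chabauty_R_Z U" "H0 \<in> U"
      "\<And>H. H \<in> U \<Longrightarrow> H \<in> non_degenerate \<and> \<bar>freq H - ?t\<bar> < d / 2"
    using freq_continuous_at[OF H0, of "d / 2"] d(1) by (metis half_gt_zero)
  define V where "V = {H \<in> topspace chabauty_R_Z. H \<inter> ball y0 (d / 2) \<times> {n} \<noteq> {}}"
  show ?thesis
  proof (rule that[of "U \<inter> V"])
    show "openin chabauty_R_Z (U \<inter> V)"
      unfolding V_def by (intro openin_Int U openin_chabauty_hit open_level) auto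
    show "H0 \<in> U \<inter> V"
      using U(2) y0 d(1) non_degenerateD[OF H0] by (auto simp: V_def)
    fix H assume HUV: "H \<in> U \<inter> V"
    then obtain y where y: "(y, n) \<in> H" "dist y0 y < d / 2" by (auto simp: V_def)
    have H: "H \<in> non_degenerate" "\<bar>freq H - ?t\<bar> < d / 2" using U(3) HUV by auto
    have "dist (y, freq H) (y0, ?t) \<le> dist y y0 + dist (freq H) ?t"
      unfolding dist_prod_def by (simp add: sqrt_sum_squares_le_sum)
    also have "\<dots> < d" using y(2) H(2) unfolding dist_real_def by linarith
    finally show "H \<in> non_degenerate \<and> dist (level_phase n H) (level_phase n H0) < e"
      using d(2) H(1) level_phase_eq[OF H(1) y(1)] level_phase_eq[OF H0 y0] by simp
  qed
next
  case False
  define R where "R = 1 + 2 / e"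
  have R: "R > 0" "2 / R < e" using e by (simp_all add: R_def field_simps add_pos_pos)
  define V where "V = {H \<in> topspace chabauty_R_Z. H \<inter> {-R..R} \<times> {n} = {}}"
  show ?thesis
  proof (rule that[of "non_degenerate \<inter> V"])
    show "openin chabauty_R_Z (non_degenerate \<inter> V)"
      unfolding V_def
      by (intro openin_Int openin_non_degenerate openin_chabauty_avoid compact_level) auto
    show "H0 \<in> non_degenerate \<inter> V"
      using False H0 non_degenerateD[OF H0] by (auto simp: V_def)
    fix H assume HV: "H \<in> non_degenerate \<inter> V"
    then have H: "H \<in> non_degenerate" by simp
    have "dist (level_phase n H) (- 1) < e"
    proof (cases "\<exists>y. (y, n) \<in> H")
      case True
      then obtain y where y: "(y, n) \<in> H" "\<bar>y * freq H\<bar> \<le> pi / 2"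
        using small_representative[OF H] by metis
      have "\<not> \<bar>y\<bar> \<le> R"
        using HV y(1) by (auto simp: V_def abs_le_iff)
      moreover from this have "norm (phase y (freq H) + 1) \<le> 2 / \<bar>y\<bar>"
        using R by (intro phase_near_minus_one y) auto
      moreover have "2 / \<bar>y\<bar> \<le> 2 / R"
        using R calculation(1) by (intro divide_left_mono) auto
      ultimately show ?thesis
        using R level_phase_eq[OF H y(1)] by (simp add: dist_norm)
    qed (use e in \<open>simp add: level_phase_empty\<close>)
    then show "H \<in> non_degenerate \<and> dist (level_phase n H) (level_phase n H0) < e"
      using H False by (simp add: level_phase_empty)
  qed
qed

lemma continuous_level_phase:
  "continuous_map (subtopology chabauty_R_Z non_degenerate) euclidean (level_phase n)"
proof -
  have "\<exists>U. openin (subtopology chabauty_R_Z non_degenerate) U \<and> H \<in> U \<and>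
      (\<forall>y\<in>U. level_phase n y \<in> ball (level_phase n H) e)"
    if H: "H \<in> non_degenerate" and e: "e > 0" for H e
  proof -
    obtain U where U: "openin chabauty_R_Z U" "H \<in> U"
      "\<And>H'. H' \<in> U \<Longrightarrow> H' \<in> non_degenerate \<and> dist (level_phase n H') (level_phase n H) < e"
      using level_phase_continuous_at[OF H e, of n] by metis
    have "openin (subtopology chabauty_R_Z non_degenerate) U"
      using U by (subst openin_open_subtopology[OF openin_non_degenerate]) auto
    then show ?thesis using U by (auto simp: dist_commute)
  qed
  then show ?thesis
    using Met_TC.continuous_map_to_metric[of "subtopology chabauty_R_Z non_degenerate" "level_phase n"]
    by simp
qed

section \<open>Punctures and winding functions\<close>

text \<open>For a prime \<open>p\<close> its only element is \<open>\<real> \<times> p\<int>\<close>, the centre of the disc formed by the groups generated by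
  \<open>(a, 0)\<close> and \<open>(x, p)\<close> with polar coordinates \<open>a\<close> and \<open>2\<pi>x / a\<close>.\<close>

definition puncture :: "nat \<Rightarrow> (real \<times> int) set set"
  where "puncture p = {H \<in> topspace chabauty_R_Z - non_degenerate.
    (\<exists>y. (y, int p) \<in> H) \<and> (\<forall>y. (y, 1) \<notin> H)}"

definition short_period :: "(real \<times> int) set set"
  where "short_period = {H \<in> topspace chabauty_R_Z. H \<inter> {0<..<pi} \<times> {0} \<noteq> {}}"

definition meets_level :: "int \<Rightarrow> (real \<times> int) set set"
  where "meets_level n = {H \<in> topspace chabauty_R_Z. \<exists>y. (y, n) \<in> H}"

lemma openin_short_period: "openin chabauty_R_Z short_period"
  unfolding short_period_def by (intro openin_chabauty_hit open_level) auto

lemma openin_meets_level: "openin chabauty_R_Z (meets_level n)"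
proof -
  have "meets_level n = {H \<in> topspace chabauty_R_Z. H \<inter> UNIV \<times> {n} \<noteq> {}}"
    by (auto simp: meets_level_def)
  then show ?thesis
    by (simp add: openin_chabauty_hit open_level)
qed

text \<open>Translation by a period below \<open>\<pi>\<close> brings any point of the level into a fixed compact
  interval, so missing the level is the same as avoiding that compact set.\<close>

lemma openin_misses_level: "openin chabauty_R_Z (short_period - meets_level n)"
proof -
  have "short_period - meets_level n =
      short_period \<inter> {H \<in> topspace chabauty_R_Z. H \<inter> {0..pi} \<times> {n} = {}}" (is "_ = ?R")
  proof
    show "?R \<subseteq> short_period - meets_level n"
    proof clarsimp
      fix H assume H: "H \<in> short_period" "H \<in> topspace chabauty_R_Z" "H \<in> meets_level n"
        and avoid: "H \<inter> {0..pi} \<times> {n} = {}"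
      obtain x where x: "(x, 0) \<in> H" "0 < x" "x < pi"
        using H(1) by (auto simp: short_period_def)
      obtain y where y: "(y, n) \<in> H"
        using H(3) by (auto simp: meets_level_def)
      have "(y - of_int \<lfloor>y / x\<rfloor> * x, n) \<in> H"
        using diff_in_subgroup[OF H(2) y scale_in_subgroup[OF H(2) x(1)]] by simp
      moreover have "y - of_int \<lfloor>y / x\<rfloor> * x \<in> {0..pi}"
        using floor_multiple[OF x(2), of y] x(3) by auto
      ultimately show False using avoid by auto
    qed
  qed (auto simp: short_period_def meets_level_def)
  then show ?thesis
    by (simp add: openin_short_period openin_Int openin_chabauty_avoid compact_level)
qed

lemma degenerate_short_period: "H \<in> topspace chabauty_R_Z - non_degenerate \<Longrightarrow> H \<in> short_period"
proof -
  assume "H \<in> topspace chabauty_R_Z - non_degenerate"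
  then have "H \<in> topspace chabauty_R_Z" "(pi / 2, 0) \<in> H \<inter> {0<..<pi} \<times> {0}"
    using pi_gt_zero by (auto simp: non_degenerate_def)
  then show ?thesis unfolding short_period_def by blast
qed

text \<open>The phase of level \<open>p\<close> winds around the centre of the disc \<open>p\<close>, but also \<open>p\<close> times around that of
  the disc \<open>1\<close>, whose groups meet all levels. Dividing by the \<open>p\<close>-th power of the phase of level \<open>1\<close>
  removes the second singularity and keeps the first.\<close>

definition winding_fun :: "nat \<Rightarrow> (real \<times> int) set \<Rightarrow> complex"
  where "winding_fun p H =
    (if H \<in> non_degenerate then level_phase (int p) H / level_phase 1 H ^ p else 1)"

lemma winding_fun_nonzero: "winding_fun p H \<noteq> 0"
  by (simp add: winding_fun_def level_phase_nonzero)

text \<open>On level \<open>1\<close> the phase is a character for short periods, and level \<open>p\<close> contains the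
  \<open>p\<close>-fold multiples of its points, so the quotient is exactly \<open>1\<close>. If neither level is met, the
  quotient is \<open>- 1 / (- 1) ^ p\<close>, which is where \<open>p\<close> has to be odd.\<close>

lemma winding_fun_short_period:
  assumes p: "odd p" and H: "H \<in> short_period" and
    lev: "H \<in> meets_level 1 \<or> H \<notin> meets_level (int p)"
  shows "winding_fun p H = 1"
proof (cases "H \<in> non_degenerate")
  case nd: True
  have HX: "H \<in> topspace chabauty_R_Z" using nd by (rule non_degenerateD)
  show ?thesis
  proof (cases "H \<in> meets_level 1")
    case True
    then obtain x where x: "(x, 1) \<in> H" by (auto simp: meets_level_def)
    then have px: "(p * x, int p) \<in> H"
      using scale_in_subgroup[OF HX x, of "int p"] by simp
    obtain y where y: "(y, 0) \<in> H" "0 < y" "y < pi"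
      using H by (auto simp: short_period_def)
    have "freq H \<ge> 1"
    proof (rule ccontr)
      assume "\<not> freq H \<ge> 1"
      then have "y * freq H < pi * 1"
        using y freq_nonneg[OF nd] by (intro mult_strict_mono') auto
      then show False using freq_ge[OF nd y(1,2)] by simp
    qed
    then have "level_phase (int p) H = level_phase 1 H ^ p"
      by (simp add: level_phase_eq[OF nd x] level_phase_eq[OF nd px] phase_high_freq Complex.DeMoivre
        mult_ac)
    then show ?thesis by (simp add: winding_fun_def level_phase_nonzero)
  next
    case False
    then have "level_phase 1 H = - 1" "level_phase (int p) H = - 1"
      using lev HX by (auto simp: meets_level_def intro!: level_phase_empty)
    then show ?thesis using p by (simp add: winding_fun_def)
  qed
qed (simp add: winding_fun_def)

text \<open>The non-degenerate subgroups, where the phases are continuous, and the open set of the previous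
  lemma, where the function is constant, cover everything but the puncture.\<close>

lemma continuous_winding_fun:
  assumes "odd p"
  shows "continuous_map (subtopology chabauty_R_Z (topspace chabauty_R_Z - puncture p))
    euclidean (winding_fun p)"
proof -
  let ?X = "chabauty_R_Z"
  define V where "V = short_period \<inter> meets_level 1 \<union> (short_period - meets_level (int p))"
  have V: "openin ?X V"
    unfolding V_def
    by (intro openin_Un openin_Int openin_short_period openin_meets_level openin_misses_level)
  have contV: "continuous_map (subtopology ?X V) euclidean (winding_fun p)"
  proof (rule continuous_map_eq)
    show "continuous_map (subtopology ?X V) euclidean (\<lambda>_. 1 :: complex)" by simp
    show "1 = winding_fun p H" if "H \<in> topspace (subtopology ?X V)" for H
      using that winding_fun_short_period[OF assms, of H] by (auto simp: V_def)
  qed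
  have contN: "continuous_map (subtopology ?X non_degenerate) euclidean (winding_fun p)"
  proof (rule continuous_map_eq)
    show "continuous_map (subtopology ?X non_degenerate) euclidean
        (\<lambda>H. level_phase (int p) H * inverse (level_phase 1 H) ^ p)"
    proof -
      let ?N = "subtopology ?X non_degenerate"
      have "continuous_map ?N (top_of_set (UNIV \<times> - {0}))
          (\<lambda>H. (level_phase (int p) H, level_phase 1 H))"
        unfolding continuous_map_in_subtopology
        using continuous_map_pairedI[OF continuous_level_phase[of "int p"] continuous_level_phase[of 1]]
        by (auto simp: level_phase_nonzero)
      moreover have "continuous_on (UNIV \<times> - {0}) (\<lambda>z::complex \<times> complex. fst z * inverse (snd z) ^ p)"
        by (intro continuous_intros) auto
      then have "continuous_map (top_of_set (UNIV \<times> - {0})) euclidean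
          (\<lambda>z::complex \<times> complex. fst z * inverse (snd z) ^ p)"
        by simp
      ultimately have "continuous_map ?N euclidean ((\<lambda>z. fst z * inverse (snd z) ^ p) \<circ>
          (\<lambda>H. (level_phase (int p) H, level_phase 1 H)))"
        by (rule continuous_map_compose)
      then show ?thesis by (simp add: o_def)
    qed
    show "level_phase (int p) H * inverse (level_phase 1 H) ^ p = winding_fun p H"
      if "H \<in> topspace (subtopology ?X non_degenerate)" for H
      using that by (simp add: winding_fun_def divide_inverse power_inverse)
  qed
  have cover: "topspace ?X - puncture p \<subseteq> V \<union> non_degenerate"
    using degenerate_short_period by (auto simp: V_def puncture_def meets_level_def)
  have "\<exists>U. openin ?X U \<and> H \<in> U \<and> (\<forall>H'\<in>U. winding_fun p H' \<in> ball (winding_fun p H) e)"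
    if H: "H \<in> topspace ?X - puncture p" and e: "e > 0" for H and e :: real
  proof -
    obtain W where W: "openin ?X W" "H \<in> W"
        "continuous_map (subtopology ?X W) euclidean (winding_fun p)"
    proof (cases "H \<in> V")
      case True
      then show ?thesis using that V contV by blast
    next
      case False
      then have "H \<in> non_degenerate" using H cover by auto
      then show ?thesis using that openin_non_degenerate contN by blast
    qed
    have "openin (subtopology ?X W) {H' \<in> topspace (subtopology ?X W). winding_fun p H' \<in> ball (winding_fun p H) e}"
      using W(3) by (rule openin_continuous_map_preimage) simp
    then have "openin ?X {H' \<in> topspace (subtopology ?X W). winding_fun p H' \<in> ball (winding_fun p H) e}"
      using openin_trans_full[OF _ W(1)] by blast
    moreover have "H \<in> topspace (subtopology ?X W)"
      using H W by simp
    ultimately show ?thesis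
      using e by (intro exI conjI) auto
  qed
  note local_cont = this
  have "\<exists>U. openin (subtopology ?X (topspace ?X - puncture p)) U \<and> H \<in> U \<and>
        (\<forall>H'\<in>U. winding_fun p H' \<in> ball (winding_fun p H) e)"
    if H: "H \<in> topspace ?X - puncture p" and e: "e > 0" for H and e :: real
  proof -
    obtain U where U: "openin ?X U" "H \<in> U" "\<forall>H'\<in>U. winding_fun p H' \<in> ball (winding_fun p H) e"
      using local_cont[OF H e] by blast
    then show ?thesis
      using H by (intro exI[of _ "U \<inter> (topspace ?X - puncture p)"]) (auto simp: openin_subtopology)
  qed
  then show ?thesis
    using Met_TC.continuous_map_to_metric[of "subtopology ?X (topspace ?X - puncture p)" "winding_fun p"]
    by simp
qed

text \<open>The levels met by subgroups of short period are locally constant, so they do not change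
  along a small convex piece of the parameter space; such a piece cannot reach two punctures, as a
  subgroup meeting two coprime levels meets level 1.\<close>

lemma finite_punctures:
  fixes S :: "'a::real_normed_vector set"
  assumes S: "compact S" "convex S"
    and \<sigma>: "continuous_map (top_of_set S) chabauty_R_Z \<sigma>"
  shows "finite {p. prime p \<and> \<sigma> ` S \<inter> puncture p \<noteq> {}}"
proof -
  define P where "P N = {p. prime p \<and> (\<exists>r\<in>S \<inter> N. \<sigma> r \<in> puncture p)}" for N
  have open_pre: "openin (top_of_set S) {r \<in> S. \<sigma> r \<in> U}" if "openin chabauty_R_Z U" for U
    using openin_continuous_map_preimage[OF \<sigma> that] by simp
  have "\<exists>N. open N \<and> s \<in> N \<and> finite (P N)" if s: "s \<in> S" for s
  proof (cases "\<sigma> s \<in> non_degenerate")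
    case True
    obtain N where N: "open N" "{r \<in> S. \<sigma> r \<in> non_degenerate} = S \<inter> N"
      using open_pre[OF openin_non_degenerate] by (auto simp: openin_open)
    have "P N = {}"
      using N(2) by (auto simp: P_def puncture_def)
    then show ?thesis using N True s by (intro exI[of _ N]) auto
  next
    case False
    have "\<sigma> s \<in> topspace chabauty_R_Z"
      using continuous_map_image_subset_topspace[OF \<sigma>] s by auto
    then have "\<sigma> s \<in> short_period"
      using False degenerate_short_period by blast
    moreover obtain N where N: "open N" "{r \<in> S. \<sigma> r \<in> short_period} = S \<inter> N"
      using open_pre[OF openin_short_period] by (auto simp: openin_open)
    ultimately have "s \<in> N"
      using s by blast
    then obtain d where d: "d > 0" "ball s d \<subseteq> N"
      using N(1) openE by blast
    define C where "C = S \<inter> ball s d"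
    have short: "\<sigma> r \<in> short_period" if "r \<in> C" for r
      using that N(2) d(2) by (auto simp: C_def)
    have "connected C"
      unfolding C_def using S by (intro convex_connected convex_Int) auto
    have const: "\<sigma> r' \<in> meets_level n" if "r \<in> C" "\<sigma> r \<in> meets_level n" "r' \<in> C" for r r' n
    proof -
      have "openin (top_of_set C) {r \<in> C. \<sigma> r \<in> U}" if "openin chabauty_R_Z U" for U
      proof -
        have "{r \<in> C. \<sigma> r \<in> U} = ball s d \<inter> {r \<in> S. \<sigma> r \<in> U}" by (auto simp: C_def)
        then show ?thesis
          using openin_subtopology_Int2[OF open_pre[OF that], of "ball s d"]
          by (simp only: C_def subtopology_subtopology)
      qed
      note open_C = this
      have "{r \<in> C. \<sigma> r \<in> short_period - meets_level n} = C - {r \<in> C. \<sigma> r \<in> meets_level n}"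
        using short by auto
      then have "openin (top_of_set C) (C - {r \<in> C. \<sigma> r \<in> meets_level n})"
        using open_C[OF openin_misses_level[of n]] by simp
      moreover have "openin (top_of_set C) {r \<in> C. \<sigma> r \<in> meets_level n}"
        by (rule open_C[OF openin_meets_level])
      ultimately have "{r \<in> C. \<sigma> r \<in> meets_level n} = {} \<or> {r \<in> C. \<sigma> r \<in> meets_level n} = C"
        using \<open>connected C\<close> unfolding connected_clopen
        by (metis (no_types, lifting) closedin_def mem_Collect_eq subsetI topspace_euclidean_subtopology)
      then show ?thesis using that by blast
    qed
    have "p = q" if pq: "p \<in> P (ball s d)" "q \<in> P (ball s d)" for p q
    proof (rule ccontr)
      assume "p \<noteq> q"
      obtain r r' where r: "prime p" "r \<in> C" "\<sigma> r \<in> puncture p"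
        and r': "prime q" "r' \<in> C" "\<sigma> r' \<in> puncture q"
        using pq unfolding P_def C_def by blast
      let ?H = "\<sigma> r"
      have HX: "?H \<in> topspace chabauty_R_Z" using r(3) by (simp add: puncture_def)
      have "\<sigma> r' \<in> meets_level (int q)" using r'(3) by (auto simp: puncture_def meets_level_def)
      then have "?H \<in> meets_level (int q)" by (rule const[OF r'(2) _ r(2)])
      then obtain y where y: "(y, int q) \<in> ?H" by (auto simp: meets_level_def)
      obtain x where x: "(x, int p) \<in> ?H" using r(3) by (auto simp: puncture_def)
      have "coprime (int p) (int q)"
        using primes_coprime[OF r(1) r'(1) \<open>p \<noteq> q\<close>] by simp
      then obtain a b where "a * int p + b * int q = 1"
        using bezout_int[of "int p" "int q"] by auto
      then have "(of_int a * x + of_int b * y, 1) \<in> ?H"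
        using add_in_subgroup[OF HX scale_in_subgroup[OF HX x, of a] scale_in_subgroup[OF HX y, of b]]
        by simp
      then show False using r(3) by (auto simp: puncture_def)
    qed
    note unique = this
    have "finite (P (ball s d))"
    proof (cases "P (ball s d) = {}")
      case False
      then obtain p where "p \<in> P (ball s d)" by blast
      then have "P (ball s d) \<subseteq> {p}" using unique by blast
      then show ?thesis by (rule finite_subset) simp
    qed simp
    then show ?thesis using d(1) by (intro exI[of _ "ball s d"]) auto
  qed
  then obtain N where N: "\<And>s. s \<in> S \<Longrightarrow> open (N s) \<and> s \<in> N s \<and> finite (P (N s))"
    by metis
  have "S \<subseteq> (\<Union>s\<in>S. N s)" using N by blast
  then obtain D where D: "D \<subseteq> S" "finite D" "S \<subseteq> (\<Union>s\<in>D. N s)"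
    using compactE_image[OF S(1), of S N] N by metis
  have "{p. prime p \<and> \<sigma> ` S \<inter> puncture p \<noteq> {}} \<subseteq> (\<Union>s\<in>D. P (N s))"
  proof
    fix p assume "p \<in> {p. prime p \<and> \<sigma> ` S \<inter> puncture p \<noteq> {}}"
    then obtain r where r: "prime p" "r \<in> S" "\<sigma> r \<in> puncture p" by auto
    then obtain s where "s \<in> D" "r \<in> N s" using D(3) by auto
    then show "p \<in> (\<Union>s\<in>D. P (N s))" using r by (auto simp: P_def)
  qed
  moreover have "finite (\<Union>s\<in>D. P (N s))"
    using D N by blast
  ultimately show ?thesis by (rule finite_subset)
qed

section \<open>Path-connectedness\<close>

lemma isolated_zero:
  assumes H: "H \<in> non_degenerate"
  obtains d where "d > 0" "\<And>y. (y, n) \<in> H \<Longrightarrow> y = 0 \<or> d \<le> \<bar>y\<bar>"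
proof (cases "(0, n) \<in> H")
  case True
  have HX: "H \<in> topspace chabauty_R_Z" by (rule non_degenerateD[OF H])
  show ?thesis
  proof (rule that[of "pi / (freq H + 1)"])
    show "pi / (freq H + 1) > 0" using freq_nonneg[OF H] by simp
    fix y assume y: "(y, n) \<in> H"
    show "y = 0 \<or> pi / (freq H + 1) \<le> \<bar>y\<bar>"
    proof (rule disjCI)
      assume "\<not> pi / (freq H + 1) \<le> \<bar>y\<bar>"
      then have "\<bar>y\<bar> * (freq H + 1) < pi"
        using freq_nonneg[OF H] by (simp add: not_le pos_less_divide_eq)
      then have small: "\<bar>y\<bar> * freq H < pi"
        by (simp add: distrib_left)
      have "(y, 0) \<in> H" "(- y, 0) \<in> H"
        using diff_in_subgroup[OF HX y True] diff_in_subgroup[OF HX True y] by simp_all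
      then have "(\<bar>y\<bar>, 0) \<in> H" by (auto simp: abs_if)
      then show "y = 0"
        using freq_ge[OF H, of "\<bar>y\<bar>"] small by force
    qed
  qed
next
  case False
  then have "0 \<in> - {y. (y, n) \<in> H}" by simp
  then obtain d where d: "d > 0" "ball 0 d \<subseteq> - {y. (y, n) \<in> H}"
    using closed_slice[OF non_degenerateD[OF H]] unfolding closed_def by (meson openE)
  show ?thesis
    by (rule that[of d]) (use d in \<open>force simp: subset_iff\<close>)+
qed

text \<open>Stretching the real direction by \<open>1 / u\<close> sends all points off the vertical axis to infinity.\<close>

lemma path_stretch:
  assumes H: "H \<in> non_degenerate"
  shows "path_component_of chabauty_R_Z H ({0} \<times> {n. (0, n) \<in> H})"
proof -
  have HX: "H \<in> topspace chabauty_R_Z" by (rule non_degenerateD[OF H])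
  define F where "F u = {(x, n). (u * x, n) \<in> H \<and> (u = 0 \<longrightarrow> x = 0)}" for u :: real
  have "continuous_map (top_of_set {0..1}) chabauty_R_Z F"
  proof (rule continuous_map_chabautyI)
    show "(0, 0) \<in> F s" for s using zero_in_subgroup[OF HX] by (simp add: F_def)
    show "(x - y, m - n) \<in> F s" if "(x, m) \<in> F s" "(y, n) \<in> F s" for s x m y n
      using that diff_in_subgroup[OF HX] by (auto simp: F_def right_diff_distrib)
    show "closed {(s, x). s \<in> {0..1} \<and> (x, n) \<in> F s}" for n
    proof -
      obtain d where d: "d > 0" "\<And>y. (y, n) \<in> H \<Longrightarrow> y = 0 \<or> d \<le> \<bar>y\<bar>"
        using isolated_zero[OF H, of n] by blast
      have "{(s, x). s \<in> {0..1} \<and> (x, n) \<in> F s} =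
        ({0..1} \<times> UNIV) \<inter> (\<lambda>z. fst z * snd z) -` {y. (y, n) \<in> H} \<inter>
        ({z. snd z = 0} \<union> {z. d \<le> \<bar>fst z * snd z\<bar>})"
        using d by (fastforce simp: F_def)
      moreover have "closed ((\<lambda>z::real \<times> real. fst z * snd z) -` {y. (y, n) \<in> H})"
        by (intro closed_vimage closed_slice[OF HX] continuous_intros)
      ultimately show ?thesis
        by (auto intro!: closed_Int closed_Un closed_Times closed_Collect_eq closed_Collect_le
            continuous_intros)
    qed
    show "\<exists>g. (g \<longlongrightarrow> x) (at s within {0..1}) \<and> (\<forall>\<^sub>F r in at s within {0..1}. (g r, n) \<in> F r)"
      if "s \<in> {0..1}" "(x, n) \<in> F s" for s x n
    proof (cases "s = 0")
      case True
      then show ?thesis using that by (intro exI[of _ "\<lambda>_. 0"]) (auto simp: F_def)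
    next
      case False
      have "((\<lambda>r. s * x / r) \<longlongrightarrow> s * x / s) (at s within {0..1})"
        using False by (intro tendsto_intros)
      moreover have "\<forall>\<^sub>F r in at s within {0..1}. r \<noteq> 0"
        using False by (intro tendsto_imp_eventually_ne[OF tendsto_ident_at])
      then have "\<forall>\<^sub>F r in at s within {0..1}. (s * x / r, n) \<in> F r"
        by eventually_elim (use that False in \<open>simp add: F_def\<close>)
      ultimately show ?thesis using False by (intro exI[of _ "\<lambda>r. s * x / r"]) simp
    qed
  qed simp
  moreover have "F 1 = H" "F 0 = {0} \<times> {n. (0, n) \<in> H}"
    by (auto simp: F_def)
  ultimately have "path_component_of chabauty_R_Z ({0} \<times> {n. (0, n) \<in> H}) H"
    unfolding path_component_of_def pathin_def by blast
  then show ?thesis by (simp add: path_component_of_sym)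
qed

text \<open>The vertical subgroup tilts until its generator escapes to infinity.\<close>

lemma path_tilt:
  fixes J :: "int set"
  assumes zero: "0 \<in> J" and diff: "\<And>m n. m \<in> J \<Longrightarrow> n \<in> J \<Longrightarrow> m - n \<in> J"
  shows "path_component_of chabauty_R_Z ({0} \<times> J) {(0, 0)}"
proof -
  define F where "F u = {(x, n). n \<in> J \<and> u * x = (1 - u) * of_int n \<and> (u = 0 \<longrightarrow> x = 0)}" for u :: real
  have "continuous_map (top_of_set {0..1}) chabauty_R_Z F"
  proof (rule continuous_map_chabautyI)
    show "(0, 0) \<in> F s" for s using zero by (simp add: F_def)
    show "(x - y, m - n) \<in> F s" if "(x, m) \<in> F s" "(y, n) \<in> F s" for s x m y n
      using that diff by (auto simp: F_def right_diff_distrib)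
    show "closed {(s, x). s \<in> {0..1} \<and> (x, n) \<in> F s}" for n
    proof (cases "n \<in> J")
      case True
      have "{(s, x). s \<in> {0..1} \<and> (x, n) \<in> F s} =
        ({0..1} \<times> UNIV) \<inter> {z. fst z * snd z = (1 - fst z) * of_int n} \<inter> {z. n = 0 \<longrightarrow> snd z = 0}"
        using True by (auto simp: F_def)
      moreover have "closed {z :: real \<times> real. n = 0 \<longrightarrow> snd z = 0}"
        by (cases "n = 0") (auto intro!: closed_Collect_eq continuous_intros)
      ultimately show ?thesis
        by (simp only:) (intro closed_Int closed_Times closed_Collect_eq continuous_intros, auto)
    qed (simp add: F_def)
    show "\<exists>g. (g \<longlongrightarrow> x) (at s within {0..1}) \<and> (\<forall>\<^sub>F r in at s within {0..1}. (g r, n) \<in> F r)"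
      if "s \<in> {0..1}" "(x, n) \<in> F s" for s x n
    proof (cases "s = 0")
      case True
      then show ?thesis using that by (intro exI[of _ "\<lambda>_. 0"]) (auto simp: F_def)
    next
      case False
      have "((\<lambda>r. (1 - r) * of_int n / r) \<longlongrightarrow> (1 - s) * of_int n / s) (at s within {0..1})"
        using False by (intro tendsto_intros)
      moreover have "(1 - s) * of_int n / s = x"
        using that False by (simp add: F_def field_simps)
      moreover have "\<forall>\<^sub>F r in at s within {0..1}. r \<noteq> 0"
        using False by (intro tendsto_imp_eventually_ne[OF tendsto_ident_at])
      then have "\<forall>\<^sub>F r in at s within {0..1}. ((1 - r) * of_int n / r, n) \<in> F r"
        by eventually_elim (use that in \<open>simp add: F_def\<close>)
      ultimately show ?thesis by (intro exI[of _ "\<lambda>r. (1 - r) * of_int n / r"]) simp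
    qed
  qed simp
  moreover have "F 1 = {0} \<times> J" "F 0 = {(0, 0)}"
    using zero by (auto simp: F_def)
  ultimately have "path_component_of chabauty_R_Z {(0, 0)} ({0} \<times> J)"
    unfolding path_component_of_def pathin_def by blast
  then show ?thesis by (simp add: path_component_of_sym)
qed

text \<open>The line \<open>\<real>\<close> is the limit of the groups \<open>s\<int>\<close> as \<open>s\<close> tends to \<open>0\<close>.\<close>

lemma path_discretize:
  fixes J :: "int set"
  assumes zero: "0 \<in> J" and diff: "\<And>m n. m \<in> J \<Longrightarrow> n \<in> J \<Longrightarrow> m - n \<in> J"
  shows "path_component_of chabauty_R_Z (UNIV \<times> J) (\<int> \<times> J)"
proof -
  define F where "F s = {(x, n). n \<in> J \<and> (s \<noteq> 0 \<longrightarrow> x / s \<in> \<int>)}" for s :: real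
  have "continuous_map (top_of_set {0..1}) chabauty_R_Z F"
  proof (rule continuous_map_chabautyI)
    show "(0, 0) \<in> F s" for s using zero by (simp add: F_def)
    show "(x - y, m - n) \<in> F s" if "(x, m) \<in> F s" "(y, n) \<in> F s" for s x m y n
      using that diff by (auto simp: F_def diff_divide_distrib)
    show "closed {(s, x). s \<in> {0..1} \<and> (x, n) \<in> F s}" for n
    proof (cases "n \<in> J")
      case True
      have "x / s \<in> \<int>" if lim: "(z \<longlonglongrightarrow> (s, x))"
          and z: "\<And>i. fst (z i) \<noteq> 0 \<longrightarrow> snd (z i) / fst (z i) \<in> \<int>" and s: "s \<noteq> 0" for z :: "nat \<Rightarrow> real \<times> real" and s x
      proof -
        have f: "(\<lambda>i. fst (z i)) \<longlonglongrightarrow> s"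
          using tendsto_fst[OF lim] by simp
        have "(\<lambda>i. snd (z i) / fst (z i)) \<longlonglongrightarrow> x / s"
          using tendsto_divide[OF tendsto_snd[OF lim] f s] by simp
        moreover have "\<forall>\<^sub>F i in sequentially. snd (z i) / fst (z i) \<in> \<int>"
          using tendsto_imp_eventually_ne[OF f s] by eventually_elim (use z in blast)
        ultimately show ?thesis
          by (intro Lim_in_closed_set[OF closed_Ints]) auto
      qed
      then have "closed {(s, x :: real). s \<noteq> 0 \<longrightarrow> x / s \<in> \<int>}"
        unfolding closed_sequential_limits by (force simp: case_prod_unfold)
      moreover have "{(s, x). s \<in> {0..1} \<and> (x, n) \<in> F s} =
        ({0..1} \<times> UNIV) \<inter> {(s, x :: real). s \<noteq> 0 \<longrightarrow> x / s \<in> \<int>}"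
        using True by (auto simp: F_def)
      ultimately show ?thesis
        by (simp only:) (intro closed_Int closed_Times, auto)
    qed (simp add: F_def)
    show "\<exists>g. (g \<longlongrightarrow> x) (at s within {0..1}) \<and> (\<forall>\<^sub>F r in at s within {0..1}. (g r, n) \<in> F r)"
      if s: "s \<in> {0..1}" and x: "(x, n) \<in> F s" for s x n
    proof (cases "s = 0")
      case True
      let ?g = "\<lambda>r. of_int \<lfloor>x / r\<rfloor> * r"
      have "norm (?g r - x) \<le> r" if "r \<noteq> 0" "r \<in> {0..1}" for r
        using floor_multiple[of r x] that by auto
      then have bound: "\<forall>\<^sub>F r in at s within {0..1}. norm (?g r - x) \<le> r"
        using True by (auto simp: eventually_at_filter)
      have "((\<lambda>r. ?g r - x) \<longlongrightarrow> 0) (at s within {0..1})"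
        by (rule Lim_null_comparison[OF bound]) (use True in \<open>auto intro!: tendsto_eq_intros\<close>)
      then have "(?g \<longlongrightarrow> x) (at s within {0..1})"
        by (simp add: LIM_zero_iff)
      then show ?thesis
        using x by (intro exI[of _ ?g]) (auto simp: F_def)
    next
      case False
      then have "((\<lambda>r. x / s * r) \<longlongrightarrow> x / s * s) (at s within {0..1})"
        by (intro tendsto_intros)
      then show ?thesis
        using x False by (intro exI[of _ "\<lambda>r. x / s * r"]) (auto simp: F_def)
    qed
  qed simp
  moreover have "F 0 = UNIV \<times> J" "F 1 = \<int> \<times> J"
    by (auto simp: F_def)
  ultimately show ?thesis
    unfolding path_component_of_def pathin_def by blast
qed

lemma path_to_trivial:
  assumes HX: "H \<in> topspace chabauty_R_Z"
  shows "path_component_of chabauty_R_Z H {(0, 0)}"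
proof -
  let ?J = "\<lambda>H. {n. (0 :: real, n :: int) \<in> H}"
  have J: "0 \<in> ?J H" "\<And>m n. m \<in> ?J H \<Longrightarrow> n \<in> ?J H \<Longrightarrow> m - n \<in> ?J H"
    if "H \<in> topspace chabauty_R_Z" for H
    using zero_in_subgroup[OF that] diff_in_subgroup[OF that, of 0 _ 0] by auto
  have nd: "path_component_of chabauty_R_Z H {(0, 0)}" if "H \<in> non_degenerate" for H
    using path_component_of_trans[OF path_stretch[OF that] path_tilt[of "?J H"]]
      J[OF non_degenerateD[OF that]] by blast
  show ?thesis
  proof (cases "H \<in> non_degenerate")
    case False
    then have all: "(x, 0) \<in> H" for x using HX by (simp add: non_degenerate_def)
    have "(0, n) \<in> H" if "(x, n) \<in> H" for x n
      using diff_in_subgroup[OF HX that all, of x] by simp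
    moreover have "(x, n) \<in> H" if "(0, n) \<in> H" for x n
      using add_in_subgroup[OF HX that all, of x] by simp
    ultimately have iff: "(x, n) \<in> H \<longleftrightarrow> (0, n) \<in> H" for x n
      by blast
    have "H = UNIV \<times> ?J H"
    proof (rule Set.set_eqI)
      show "z \<in> H \<longleftrightarrow> z \<in> UNIV \<times> ?J H" for z
        using iff[of "fst z" "snd z"] by (cases z) simp
    qed
    then have p: "path_component_of chabauty_R_Z H (\<int> \<times> ?J H)"
      using path_discretize[of "?J H"] J[OF HX] by metis
    have "(1 / 2 :: real) \<notin> \<int>"
    proof
      assume "(1 / 2 :: real) \<in> \<int>"
      then obtain k :: int where "(1 / 2 :: real) = of_int k" by (rule Ints_cases)
      then have "of_int (2 * k) = (1 :: real)" by simp
      then have "2 * k = 1" by (simp only: of_int_eq_1_iff)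
      then show False by presburger
    qed
    then have "(1 / 2 :: real, 0) \<notin> \<int> \<times> ?J H" by blast
    then have "\<int> \<times> ?J H \<in> non_degenerate"
      using path_component_in_topspace[OF p] unfolding non_degenerate_def by blast
    then show ?thesis
      using path_component_of_trans[OF p nd] by simp
  qed (rule nd)
qed

section \<open>The loops of the Hawaiian earring\<close>

text \<open>While \<open>s\<close> runs through the interval from \<open>1 / (p + 1)\<close> to \<open>1 / p\<close>, the point \<open>cot (\<pi> / s)\<close> runs once through
  the line, and for \<open>p \<in> E\<close> the value is the group generated by \<open>(cot (\<pi> / s), p)\<close>; at the other parameters it
  is trivial. The equation is cleared of denominators, so that it has no solution with \<open>n \<noteq> 0\<close> at the end
  points and the graph is visibly closed.\<close>

definition earring_loop :: "nat set \<Rightarrow> real \<Rightarrow> (real \<times> int) set"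
  where "earring_loop E s = {(x, n). n = 0 \<and> x = 0 \<or> n \<noteq> 0 \<and>
    (\<exists>p\<in>E. int p dvd n \<and> s \<in> {1 / (real p + 1)..1 / real p} \<and>
      real p * x * sin (pi / s) = of_int n * cos (pi / s))}"

lemma sin_nonzero_if_cot:
  assumes "a * sin t = b * cos t" "b \<noteq> 0" shows "sin t \<noteq> (0::real)"
  using assms sin_zero_abs_cos_one[of t] by auto

lemma sin_pi_over_zero: "sin (pi / (1 / real p)) = 0" "sin (pi / (1 / (real p + 1))) = 0"
proof -
  show "sin (pi / (1 / real p)) = 0"
    using sin_npi2[of p] by simp
  show "sin (pi / (1 / (real p + 1))) = 0"
    using sin_npi2[of "Suc p"] by (simp add: algebra_simps)
qed

lemma interior_if_sin_nonzero:
  assumes "s \<in> {1 / (real p + 1)..1 / real p}" "sin (pi / s) \<noteq> 0"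
  shows "s \<in> {1 / (real p + 1)<..<1 / real p}"
  using assms sin_pi_over_zero[of p] by (auto simp: order.order_iff_strict)

lemma interval_index_unique:
  assumes "s \<in> {1 / (real p + 1)<..<1 / real p}" "s \<in> {1 / (real q + 1)<..<1 / real q}"
  shows "p = q"
proof -
  have bounds: "real r < 1 / s \<and> 1 / s < real r + 1" if "s \<in> {1 / (real r + 1)<..<1 / real r}" for r
  proof -
    have "0 < 1 / (real r + 1)" by simp
    also have "\<dots> < s" using that by simp
    finally have s: "s > 0" .
    moreover have "r > 0" using that s by (cases r) auto
    ultimately show ?thesis using that by (simp add: field_simps)
  qed
  show ?thesis using bounds[OF assms(1)] bounds[OF assms(2)] by linarith
qed

text \<open>Over a fixed nonzero level only the finitely many divisors of that level contribute to the graph. This is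
  the reason why infinitely many circles can be passed in one loop.\<close>

lemma continuous_earring_loop:
  assumes E: "\<And>p. p \<in> E \<Longrightarrow> p > 0"
  shows "continuous_map (top_of_set {0..1}) chabauty_R_Z (earring_loop E)"
proof (rule continuous_map_chabautyI)
  show "(0, 0) \<in> earring_loop E s" for s by (simp add: earring_loop_def)
  show "(x - y, m - n) \<in> earring_loop E s"
    if xm: "(x, m) \<in> earring_loop E s" and yn: "(y, n) \<in> earring_loop E s" for s x m y n
  proof (cases "m = 0 \<or> n = 0")
    case True
    then show ?thesis using xm yn by (auto simp: earring_loop_def algebra_simps)
  next
    case False
    obtain p where p: "p \<in> E" "int p dvd m" "s \<in> {1 / (real p + 1)..1 / real p}"
      "real p * x * sin (pi / s) = of_int m * cos (pi / s)"
      using xm False by (auto simp: earring_loop_def)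
    obtain q where q: "q \<in> E" "int q dvd n" "s \<in> {1 / (real q + 1)..1 / real q}"
      "real q * y * sin (pi / s) = of_int n * cos (pi / s)"
      using yn False by (auto simp: earring_loop_def)
    have sin0: "sin (pi / s) \<noteq> 0"
      using sin_nonzero_if_cot[OF p(4)] False by simp
    have "p = q"
      by (rule interval_index_unique[OF interior_if_sin_nonzero[OF p(3) sin0]
            interior_if_sin_nonzero[OF q(3) sin0]])
    then have eq: "real p * (x - y) * sin (pi / s) = of_int (m - n) * cos (pi / s)"
      using p(4) q(4) by (simp add: algebra_simps)
    show ?thesis
    proof (cases "m = n")
      case True
      then have "x - y = 0" using eq sin0 E[OF p(1)] by simp
      then show ?thesis using True by (simp add: earring_loop_def)
    next
      case False
      then show ?thesis
        using p q eq \<open>p = q\<close> unfolding earring_loop_def by (auto intro!: bexI[of _ p])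
    qed
  qed
  show "closed {(s, x). s \<in> {0..1} \<and> (x, n) \<in> earring_loop E s}" for n
  proof (cases "n = 0")
    case True
    then have "{(s, x). s \<in> {0..1} \<and> (x, n) \<in> earring_loop E s} = {0..1} \<times> {0}"
      by (auto simp: earring_loop_def)
    then show ?thesis by (simp add: closed_Times)
  next
    case False
    let ?D = "{p \<in> E. int p dvd n}"
    let ?S = "\<lambda>p. {1 / (real p + 1)..1 / real p} \<times> (UNIV :: real set)"
    let ?f = "\<lambda>p z. real p * snd z * sin (pi / fst z) - of_int n * cos (pi / fst z)"
    have "p \<le> nat \<bar>n\<bar>" if "p \<in> ?D" for p
      using that dvd_imp_le_int[OF False, of "int p"] by auto
    then have "finite ?D"
      using finite_nat_set_iff_bounded_le by blast
    moreover have "closed {z \<in> ?S p. ?f p z = 0}" for p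
    proof (intro continuous_closed_preimage_constant continuous_intros)
      show "\<forall>z\<in>?S p. fst z \<noteq> 0"
      proof
        fix z assume "z \<in> ?S p"
        moreover have "0 < 1 / (real p + 1)" by simp
        ultimately have "0 < fst z" by (simp only: mem_Times_iff atLeastAtMost_iff) linarith
        then show "fst z \<noteq> 0" by simp
      qed
      then show "\<forall>z\<in>?S p. fst z \<noteq> 0" .
    qed (simp add: closed_Times)
    ultimately have "closed (\<Union>p\<in>?D. {z \<in> ?S p. ?f p z = 0})"
      by (intro closed_UN) auto
    moreover have "s \<in> {0..1}" if "p \<in> E" "s \<in> {1 / (real p + 1)..1 / real p}" for p s
    proof -
      have "1 / real p \<le> 1" "0 < 1 / (real p + 1)" using E[OF that(1)] by auto
      then show ?thesis using that(2) by (simp only: atLeastAtMost_iff) linarith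
    qed
    then have "{(s, x). s \<in> {0..1} \<and> (x, n) \<in> earring_loop E s} = (\<Union>p\<in>?D. {z \<in> ?S p. ?f p z = 0})"
      using False unfolding earring_loop_def by fastforce
    ultimately show ?thesis by simp
  qed
  show "\<exists>g. (g \<longlongrightarrow> x) (at s within {0..1}) \<and>
      (\<forall>\<^sub>F r in at s within {0..1}. (g r, n) \<in> earring_loop E r)"
    if s: "s \<in> {0..1}" and x: "(x, n) \<in> earring_loop E s" for s x n
  proof (cases "n = 0")
    case True
    then show ?thesis using x by (intro exI[of _ "\<lambda>_. 0"]) (auto simp: earring_loop_def)
  next
    case False
    obtain p where p: "p \<in> E" "int p dvd n" "s \<in> {1 / (real p + 1)..1 / real p}"
      "real p * x * sin (pi / s) = of_int n * cos (pi / s)"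
      using x False by (auto simp: earring_loop_def)
    have sin0: "sin (pi / s) \<noteq> 0"
      using sin_nonzero_if_cot[OF p(4)] False by simp
    let ?I = "{1 / (real p + 1)<..<1 / real p}"
    have I: "s \<in> ?I" by (rule interior_if_sin_nonzero[OF p(3) sin0])
    have s0: "s \<noteq> 0" using sin0 by auto
    let ?g = "\<lambda>r. of_int n * cos (pi / r) / (real p * sin (pi / r))"
    have "(?g \<longlongrightarrow> ?g s) (at s within {0..1})"
      using s0 sin0 E[OF p(1)] by (intro tendsto_intros) auto
    moreover have "?g s = x"
      using p(4) sin0 E[OF p(1)] by (simp add: field_simps)
    ultimately have g: "(?g \<longlongrightarrow> x) (at s within {0..1})" by simp
    have I_near: "\<forall>\<^sub>F r in at s within {0..1}. r \<in> ?I"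
      using topological_tendstoD[OF tendsto_ident_at, of ?I s] I by simp
    have "((\<lambda>r. sin (pi / r)) \<longlongrightarrow> sin (pi / s)) (at s within {0..1})"
      using s0 by (intro tendsto_intros)
    then have "\<forall>\<^sub>F r in at s within {0..1}. sin (pi / r) \<noteq> 0"
      using sin0 by (rule tendsto_imp_eventually_ne)
    with I_near have "\<forall>\<^sub>F r in at s within {0..1}. (?g r, n) \<in> earring_loop E r"
      by eventually_elim
        (use p False E[OF p(1)] in \<open>auto simp: earring_loop_def intro!: bexI[of _ p]\<close>)
    with g show ?thesis by (intro exI[of _ ?g]) simp
  qed
qed simp

lemma earring_loop_ends:
  assumes "\<And>p. p \<in> E \<Longrightarrow> p > 1"
  shows "earring_loop E 0 = {(0, 0)}" "earring_loop E 1 = {(0, 0)}"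
proof -
  have "\<not> 1 / (real p + 1) \<le> 0" for p
    using divide_pos_pos[of 1 "real p + 1"] by simp
  then show "earring_loop E 0 = {(0, 0)}"
    by (auto simp: earring_loop_def)
  have "\<not> 1 \<le> 1 / real p" if "p \<in> E" for p
    using assms[OF that] by simp
  then show "earring_loop E 1 = {(0, 0)}"
    by (auto simp: earring_loop_def)
qed

text \<open>The truncated \<open>s\<close> makes a single formula valid on the whole interval: at both end points
  \<open>1 / (p + 1)\<close> and \<open>1 / p\<close> the value is \<open>1\<close>, and in between the function turns once around the circle.\<close>

lemma winding_fun_earring_loop:
  assumes E: "E \<subseteq> {p. prime p \<and> odd p}" and p: "prime p" "odd p" and s: "s \<in> {0..1}"
  shows "winding_fun p (earring_loop E s) =
    (if p \<in> E then cis (- 2 * pi / max (1 / (real p + 1)) (min s (1 / real p))) else 1)"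
proof -
  let ?H = "earring_loop E s"
  have pos: "q > 0" if "q \<in> E" for q
    using that E prime_gt_0_nat by auto
  have HX: "?H \<in> topspace chabauty_R_Z"
    using continuous_map_image_subset_topspace[OF continuous_earring_loop[of E]] pos s by auto
  have nd: "?H \<in> non_degenerate"
    using HX by (auto simp: non_degenerate_def earring_loop_def intro!: exI[of _ 1])
  have freq: "freq ?H = 0" by (simp add: freq_def earring_loop_def)
  have "\<not> int q dvd 1" if "q \<in> E" for q
    using that E by auto
  then have level1: "level_phase 1 ?H = - 1"
    by (intro level_phase_empty) (auto simp: earring_loop_def)
  have q: "q = p" if "q \<in> E" "int q dvd int p" for q
    using that E p primes_dvd_imp_eq[of q p] by auto
  let ?I = "{1 / (real p + 1)..1 / real p}"
  have levelp: "(x, int p) \<in> ?H \<longleftrightarrow> p \<in> E \<and> s \<in> ?I \<and> x * sin (pi / s) = cos (pi / s)" for x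
  proof
    assume "(x, int p) \<in> ?H"
    then obtain r where r: "r \<in> E" "int r dvd int p" "s \<in> {1 / (real r + 1)..1 / real r}"
        "real r * x * sin (pi / s) = of_int (int p) * cos (pi / s)"
      using prime_gt_0_nat[OF p(1)] by (auto simp: earring_loop_def)
    have "r = p" using q[OF r(1,2)] .
    then show "p \<in> E \<and> s \<in> ?I \<and> x * sin (pi / s) = cos (pi / s)"
      using r prime_gt_0_nat[OF p(1)] by simp
  next
    assume "p \<in> E \<and> s \<in> ?I \<and> x * sin (pi / s) = cos (pi / s)"
    then show "(x, int p) \<in> ?H"
      using prime_gt_0_nat[OF p(1)] unfolding earring_loop_def by (auto intro!: bexI[of _ p])
  qed
  have wf: "winding_fun p ?H = - level_phase (int p) ?H"
    using nd p(2) by (simp add: winding_fun_def level1)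
  have one_if_sin: "cis (- 2 * t) = 1" if "sin t = 0" for t
    using that by (simp add: complex_eq_iff cos_double_sin sin_double)
  show ?thesis
  proof (cases "p \<in> E \<and> s \<in> ?I \<and> sin (pi / s) \<noteq> 0")
    case True
    then have "(cos (pi / s) / sin (pi / s), int p) \<in> ?H"
      by (simp add: levelp)
    then have "winding_fun p ?H = cis (- 2 * (pi / s))"
      unfolding wf level_phase_eq[OF nd \<open>(_, int p) \<in> ?H\<close>] freq
      using True by (simp add: phase_zero_freq)
    moreover have "max (1 / (real p + 1)) (min s (1 / real p)) = s"
      using True by simp
    ultimately show ?thesis using True by simp
  next
    case False
    have "level_phase (int p) ?H = - 1"
    proof (rule level_phase_empty, rule notI)
      fix x assume "(x, int p) \<in> ?H"
      then have "x * sin (pi / s) = 1 * cos (pi / s)" "p \<in> E \<and> s \<in> ?I"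
        by (simp_all add: levelp)
      then show False using False sin_nonzero_if_cot[of x "pi / s" 1] by simp
    qed
    then have one: "winding_fun p ?H = 1" by (simp add: wf)
    have "cis (- 2 * (pi / max (1 / (real p + 1)) (min s (1 / real p)))) = 1" if "p \<in> E"
    proof (rule one_if_sin)
      have le: "1 / (real p + 1) \<le> 1 / real p"
        using prime_gt_0_nat[OF p(1)] by (simp add: field_simps)
      consider "s \<in> ?I" | "s < 1 / (real p + 1)" | "s > 1 / real p" by force
      then show "sin (pi / max (1 / (real p + 1)) (min s (1 / real p))) = 0"
      proof cases
        case 1
        then have "max (1 / (real p + 1)) (min s (1 / real p)) = s" by simp
        then show ?thesis using False 1 that by simp
      next
        case 2
        then have "max (1 / (real p + 1)) (min s (1 / real p)) = 1 / (real p + 1)" using le by simp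
        then show ?thesis by (simp only: sin_pi_over_zero)
      next
        case 3
        then have "max (1 / (real p + 1)) (min s (1 / real p)) = 1 / real p" using le by simp
        then show ?thesis by (simp only: sin_pi_over_zero)
      qed
    qed
    then show ?thesis using one by simp
  qed
qed

section \<open>Change of the logarithm along a path\<close>

text \<open>This is meaningful for functions that have a continuous logarithm; for closed curves it is
  \<open>2\<pi>\<i>\<close> times the winding number around \<open>0\<close>.\<close>

definition log_change :: "(real \<Rightarrow> complex) \<Rightarrow> complex"
  where "log_change g = (THE d. \<exists>L. continuous_on {0..1} L \<and> (\<forall>s\<in>{0..1}. exp (L s) = g s) \<and> d = L 1 - L 0)"

lemma log_change_unique:
  fixes L M :: "real \<Rightarrow> complex"
  assumes L: "continuous_on {0..1} L" and M: "continuous_on {0..1} M"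
    and eq: "\<And>s. s \<in> {0..1} \<Longrightarrow> exp (L s) = exp (M s)"
  shows "L 1 - L 0 = M 1 - M 0"
proof -
  let ?f = "\<lambda>s. (L s - M s) / (of_real (2 * pi) * \<i>)"
  have "?f s \<in> \<int>" if s: "s \<in> {0..1}" for s
  proof -
    obtain n :: int where "L s = M s + of_real (of_int (2 * n) * pi) * \<i>"
      using eq[OF s] by (auto simp: exp_eq)
    then have "?f s = of_int n" by (simp add: field_simps)
    then show ?thesis by simp
  qed
  moreover have "continuous_on {0..1} ?f"
    by (intro continuous_intros L M) auto
  moreover have "1 \<le> norm (b - a)" if ab: "a \<in> \<int>" "b \<in> \<int>" "b \<noteq> a" for a b :: complex
  proof -
    obtain m n :: int where "a = of_int m" "b = of_int n"
      using ab by (auto elim!: Ints_cases)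
    then have "norm (b - a) = of_int \<bar>n - m\<bar>" "n \<noteq> m"
      using norm_of_int[of "n - m", where 'a = complex] ab by auto
    then show ?thesis by linarith
  qed
  ultimately have "?f constant_on {0..1}"
    by (intro continuous_discrete_range_constant[OF connected_Icc] exI[of _ 1])
      (blast intro: zero_less_one)+
  then obtain c where c: "\<And>s. s \<in> {0..1} \<Longrightarrow> ?f s = c"
    unfolding constant_on_def by blast
  have "?f 0 = c" "?f 1 = c"
    by (rule c, simp)+
  then have "?f 0 = ?f 1"
    by (simp only:)
  then show ?thesis by (simp add: algebra_simps)
qed

lemma log_change_eq:
  assumes "continuous_on {0..1} L" "\<And>s. s \<in> {0..1} \<Longrightarrow> exp (L s) = g s"
  shows "log_change g = L 1 - L 0"
  unfolding log_change_def
proof (rule the_equality)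
  show "\<exists>M. continuous_on {0..1} M \<and> (\<forall>s\<in>{0..1}. exp (M s) = g s) \<and> L 1 - L 0 = M 1 - M 0"
    using assms by blast
  show "d = L 1 - L 0"
    if "\<exists>M. continuous_on {0..1} M \<and> (\<forall>s\<in>{0..1}. exp (M s) = g s) \<and> d = M 1 - M 0" for d
    using that log_change_unique[OF assms(1)] assms(2) by metis
qed

lemma log_change_cong: "(\<And>s. s \<in> {0..1} \<Longrightarrow> f s = g s) \<Longrightarrow> log_change f = log_change g"
  unfolding log_change_def by (metis (no_types, lifting))

lemma log_change_const: "c \<noteq> 0 \<Longrightarrow> log_change (\<lambda>_. c) = 0"
  using log_change_eq[of "\<lambda>_. Ln c" "\<lambda>_. c"] by simp

lemma log_change_earring:
  assumes E: "E \<subseteq> {p. prime p \<and> odd p}" and p: "prime p" "odd p"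
  shows "log_change (\<lambda>s. winding_fun p (earring_loop E s)) = (if p \<in> E then 2 * of_real pi * \<i> else 0)"
proof (cases "p \<in> E")
  case True
  let ?c = "\<lambda>s. max (1 / (real p + 1)) (min s (1 / real p))"
  let ?L = "\<lambda>s. \<i> * of_real (- 2 * pi / ?c s)"
  have pos: "?c s \<noteq> 0" for s
  proof -
    have "0 < 1 / (real p + 1)" "1 / (real p + 1) \<le> ?c s" by simp_all
    then show ?thesis by linarith
  qed
  have p0: "real p > 0" using prime_gt_0_nat[OF p(1)] by simp
  have "log_change (\<lambda>s. winding_fun p (earring_loop E s)) = ?L 1 - ?L 0"
  proof (rule log_change_eq)
    show "continuous_on {0..1} ?L"
      by (intro continuous_intros) (use pos in blast)
    show "exp (?L s) = winding_fun p (earring_loop E s)" if "s \<in> {0..1}" for s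
      using winding_fun_earring_loop[OF E p that] True by (simp only: cis_conv_exp if_True)
  qed
  moreover have "1 / real p \<le> 1"
    using prime_gt_1_nat[OF p(1)] by simp
  then have "?c 1 = 1 / real p" "?c 0 = 1 / (real p + 1)"
    using p0 by (auto simp: max_def min_def field_simps)
  then have "?L 1 - ?L 0 = 2 * of_real pi * \<i>"
    by (simp add: algebra_simps)
  ultimately show ?thesis using True by simp
next
  case False
  then have "log_change (\<lambda>s. winding_fun p (earring_loop E s)) = log_change (\<lambda>_. 1)"
    using winding_fun_earring_loop[OF E p] by (intro log_change_cong) simp
  then show ?thesis using False log_change_const[of 1] by simp
qed

text \<open>A square avoiding the puncture carries a continuous logarithm, so the change along any path
  in the square depends only on its end points.\<close>

lemma log_on_square:
  fixes K :: "real \<times> real \<Rightarrow> (real \<times> int) set"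
  assumes K: "continuous_map (top_of_set ({0..1} \<times> {0..1})) chabauty_R_Z K"
    and avoid: "K ` ({0..1} \<times> {0..1}) \<inter> puncture p = {}" and p: "odd p"
  obtains L where "continuous_on ({0..1} \<times> {0..1}) L"
    "\<And>g. continuous_on {0..1} g \<Longrightarrow> g ` {0..1} \<subseteq> {0..1} \<times> {0..1} \<Longrightarrow>
      log_change (\<lambda>s. winding_fun p (K (g s))) = L (g 1) - L (g 0)"
proof -
  let ?Q = "{0..1} \<times> {0..1} :: (real \<times> real) set"
  let ?X = "chabauty_R_Z"
  have "continuous_map (top_of_set ?Q) (subtopology ?X (topspace ?X - puncture p)) K"
    using K continuous_map_image_subset_topspace[OF K] avoid
    by (auto simp: continuous_map_in_subtopology)
  then have "continuous_map (top_of_set ?Q) euclidean (winding_fun p \<circ> K)"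
    using continuous_winding_fun[OF p] by (rule continuous_map_compose)
  then have "continuous_on ?Q (\<lambda>z. winding_fun p (K z))"
    by (simp add: o_def)
  moreover have "contractible ?Q"
    by (intro convex_imp_contractible convex_Times) auto
  ultimately obtain L where L: "continuous_on ?Q L" "\<And>z. z \<in> ?Q \<Longrightarrow> winding_fun p (K z) = exp (L z)"
    using winding_fun_nonzero continuous_logarithm_on_contractible[of ?Q "\<lambda>z. winding_fun p (K z)"]
    by metis
  show ?thesis
  proof (rule that[OF L(1)])
    fix g :: "real \<Rightarrow> real \<times> real"
    assume g: "continuous_on {0..1} g" "g ` {0..1} \<subseteq> ?Q"
    show "log_change (\<lambda>s. winding_fun p (K (g s))) = L (g 1) - L (g 0)"
      using g L by (intro log_change_eq[of "\<lambda>s. L (g s)"] continuous_on_compose2[OF L(1)])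
        (auto simp: image_subset_iff)
  qed
qed

section \<open>The first homology group\<close>

definition chain_eval :: "('a \<Rightarrow> complex) \<Rightarrow> ('a \<Rightarrow>\<^sub>0 int) \<Rightarrow> complex"
  where "chain_eval f c = (\<Sum>x\<in>Poly_Mapping.keys c. of_int (Poly_Mapping.lookup c x) * f x)"

lemma chain_eval_superset:
  assumes "finite A" "Poly_Mapping.keys c \<subseteq> A"
  shows "chain_eval f c = (\<Sum>x\<in>A. of_int (Poly_Mapping.lookup c x) * f x)"
  unfolding chain_eval_def
  by (rule sum.mono_neutral_left[OF assms]) (simp add: in_keys_iff)

lemma chain_eval_0 [simp]: "chain_eval f 0 = 0"
  and chain_eval_of [simp]: "chain_eval f (frag_of x) = f x"
  by (simp_all add: chain_eval_def)

lemma chain_eval_add: "chain_eval f (a + b) = chain_eval f a + chain_eval f b"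
proof -
  let ?A = "Poly_Mapping.keys a \<union> Poly_Mapping.keys b"
  have "chain_eval f c = (\<Sum>x\<in>?A. of_int (Poly_Mapping.lookup c x) * f x)" if "c \<in> {a, b, a + b}" for c
    using that keys_add[of a b] by (intro chain_eval_superset) auto
  then show ?thesis
    by (simp add: lookup_add distrib_right sum.distrib)
qed

lemma chain_eval_cmul: "chain_eval f (frag_cmul k a) = of_int k * chain_eval f a"
  using chain_eval_superset[of "Poly_Mapping.keys a" "frag_cmul k a" f] keys_cmul[of k a]
  by (simp add: chain_eval_def sum_distrib_left mult.assoc)

lemma chain_eval_diff: "chain_eval f (a - b) = chain_eval f a - chain_eval f b"
  using chain_eval_add[of f "a - b" b] by simp

lemma chain_eval_sum: "finite A \<Longrightarrow> chain_eval f (\<Sum>i\<in>A. g i) = (\<Sum>i\<in>A. chain_eval f (g i))"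
  by (induction A rule: finite_induct) (simp_all add: chain_eval_add)

definition edge :: "real \<Rightarrow> nat \<Rightarrow> real"
  where "edge u i = (if i = 0 then 1 - u else if i = 1 then u else 0)"

text \<open>The collapse of one side of the unit square onto a vertex of the triangle, so that its other
  three sides become the three edges.\<close>

definition square_to_simplex :: "real \<times> real \<Rightarrow> nat \<Rightarrow> real"
  where "square_to_simplex z i =
    (if i = 0 then 1 - fst z else if i = 1 then fst z * (1 - snd z) else if i = 2 then fst z * snd z
     else 0)"

lemma continuous_square_to_simplex:
  "continuous_map (top_of_set ({0..1} \<times> {0..1})) (subtopology (powertop_real UNIV) (standard_simplex 2))
    square_to_simplex"
proof -
  have "continuous_map (top_of_set ({0..1} \<times> {0..1})) (powertop_real UNIV) square_to_simplex"
    unfolding continuous_map_componentwise_UNIV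
  proof
    fix i
    have "continuous_on ({0..1} \<times> {0..1}) (\<lambda>z. square_to_simplex z i)"
      unfolding square_to_simplex_def
      by (cases "i = 0"; cases "i = 1"; cases "i = 2") (simp_all add: continuous_intros)
    then show "continuous_map (top_of_set ({0..1} \<times> {0..1})) euclideanreal (\<lambda>z. square_to_simplex z i)"
      by simp
  qed
  moreover have "square_to_simplex z \<in> standard_simplex 2" if zQ: "z \<in> {0..1} \<times> {0..1}" for z
  proof -
    obtain x y where z: "z = (x, y)" "0 \<le> x" "x \<le> 1" "0 \<le> y" "y \<le> 1"
      using zQ by auto
    have "0 \<le> x * y" "x * y \<le> x" using z by (auto intro: mult_left_le)
    moreover have "x \<le> 1 + x * y" "x * y \<le> 1" using calculation z by linarith+
    ultimately show ?thesis
      using z unfolding standard_simplex_def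
      by (auto simp: square_to_simplex_def numeral_2_eq_2 algebra_simps)
  qed
  ultimately show ?thesis
    by (auto simp: continuous_map_in_subtopology)
qed

lemma edge_in_simplex: "u \<in> {0..1} \<Longrightarrow> edge u \<in> standard_simplex 1"
  by (auto simp: standard_simplex_def edge_def)

lemma simplical_face_edge:
  "simplical_face 0 (edge u) = square_to_simplex (1, u)"
  "simplical_face 1 (edge u) = square_to_simplex (u, 1)"
  "simplical_face 2 (edge u) = square_to_simplex (u, 0)"
  by (auto simp: simplical_face_def edge_def square_to_simplex_def fun_eq_iff)

definition edge_log_change :: "nat \<Rightarrow> ((nat \<Rightarrow> real) \<Rightarrow> (real \<times> int) set) \<Rightarrow> complex"
  where "edge_log_change p \<sigma> = log_change (\<lambda>u. winding_fun p (\<sigma> (edge u)))"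

text \<open>The change of the logarithm is a 1-cocycle on the complement of the puncture: on the square the
  changes along the edges are differences of values of one logarithm, and the collapsed side contributes nothing.\<close>

lemma edge_log_change_boundary:
  assumes \<tau>: "singular_simplex 2 chabauty_R_Z \<tau>"
    and avoid: "(\<tau> \<circ> square_to_simplex) ` ({0..1} \<times> {0..1}) \<inter> puncture p = {}" and p: "odd p"
  shows "chain_eval (edge_log_change p)
    (\<Sum>k\<le>2. frag_cmul ((-1) ^ k) (frag_of (singular_face 2 k \<tau>))) = 0"
proof -
  let ?K = "\<tau> \<circ> square_to_simplex"
  have K: "continuous_map (top_of_set ({0..1} \<times> {0..1})) chabauty_R_Z ?K"
    using \<tau> unfolding singular_simplex_def
    by (intro continuous_map_compose[OF continuous_square_to_simplex]) auto
  obtain L where L: "continuous_on ({0..1} \<times> {0..1}) L"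
    "\<And>g. continuous_on {0..1} g \<Longrightarrow> g ` {0..1} \<subseteq> {0..1} \<times> {0..1} \<Longrightarrow>
      log_change (\<lambda>s. winding_fun p (?K (g s))) = L (g 1) - L (g 0)"
    by (rule log_on_square[OF K avoid p]) blast
  have face: "edge_log_change p (singular_face 2 k \<tau>) = L (g 1) - L (g 0)"
    if "\<And>u. simplical_face k (edge u) = square_to_simplex (g u)"
      "continuous_on {0..1} g" "g ` {0..1} \<subseteq> {0..1} \<times> {0..1}" for k g
  proof -
    have "edge_log_change p (singular_face 2 k \<tau>) = log_change (\<lambda>s. winding_fun p (?K (g s)))"
      unfolding edge_log_change_def
      by (intro log_change_cong) (simp add: singular_face_def edge_in_simplex[unfolded One_nat_def] that(1))
    then show ?thesis using L(2)[OF that(2,3)] by simp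
  qed
  have "edge_log_change p (singular_face 2 0 \<tau>) = L (1, 1) - L (1, 0)"
    by (rule face[of _ "\<lambda>u. (1, u)"]) (auto simp: simplical_face_edge intro!: continuous_intros)
  moreover have "edge_log_change p (singular_face 2 1 \<tau>) = L (1, 1) - L (0, 1)"
    by (rule face[of _ "\<lambda>u. (u, 1)"]) (auto simp: simplical_face_edge[simplified] intro!: continuous_intros)
  moreover have "edge_log_change p (singular_face 2 2 \<tau>) = L (1, 0) - L (0, 0)"
    by (rule face[of _ "\<lambda>u. (u, 0)"]) (auto simp: simplical_face_edge intro!: continuous_intros)
  moreover have "L (0, 1) - L (0, 0) = 0"
  proof -
    have eq: "square_to_simplex (0, s) = (\<lambda>i. if i = 0 then 1 else 0)" for s
      by (auto simp: square_to_simplex_def)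
    have "log_change (\<lambda>s. winding_fun p (?K (0, s))) = L (0, 1) - L (0, 0)"
      by (rule L(2)) (auto intro!: continuous_intros)
    moreover have "log_change (\<lambda>s. winding_fun p (?K (0, s))) = 0"
      using log_change_const[OF winding_fun_nonzero] by (simp add: eq)
    ultimately show ?thesis by simp
  qed
  ultimately show ?thesis
    by (simp add: numeral_2_eq_2 chain_eval_add chain_eval_cmul chain_eval_diff)
qed

definition loop_simplex :: "(real \<Rightarrow> 'a) \<Rightarrow> (nat \<Rightarrow> real) \<Rightarrow> 'a"
  where "loop_simplex c = restrict (\<lambda>x. c (x 1)) (standard_simplex 1)"

lemma loop_simplex_cycle:
  assumes c: "continuous_map (top_of_set {0..1}) X c" and closed: "c 0 = c 1"
  shows "singular_relcycle 1 X {} (frag_of (loop_simplex c))"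
  unfolding singular_cycle
proof
  let ?D = "subtopology (powertop_real UNIV) (standard_simplex 1)"
  have "continuous_map ?D (top_of_set {0..1}) (\<lambda>x. x 1)"
    unfolding continuous_map_in_subtopology
    by (auto intro!: continuous_map_from_subtopology continuous_map_product_projection
      simp: standard_simplex_def)
  then have "continuous_map ?D X (c \<circ> (\<lambda>x. x 1))"
    using c by (rule continuous_map_compose)
  then have "continuous_map ?D X (loop_simplex c)"
    by (rule continuous_map_eq) (simp add: loop_simplex_def)
  then show "singular_chain 1 X (frag_of (loop_simplex c))"
    by (simp add: singular_chain_of singular_simplex_def loop_simplex_def)
  have "singular_face 1 k (loop_simplex c) = restrict (\<lambda>_. c 1) (standard_simplex 0)" if "k \<le> 1" for k
  proof -
    have "c (simplical_face k x 1) = c 1" if "x \<in> standard_simplex 0" for x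
      using that \<open>k \<le> 1\<close> closed by (cases "k = 0") (auto simp: standard_simplex_0 simplical_face_def)
    then show ?thesis
      using simplical_face_in_standard_simplex[of 1 k] \<open>k \<le> 1\<close>
      by (auto simp: singular_face_def loop_simplex_def fun_eq_iff)
  qed
  then show "chain_boundary 1 (frag_of (loop_simplex c)) = 0"
    by (simp add: chain_boundary_of)
qed

text \<open>Only finitely many punctures are reached by a 2-chain, so two homologous loops have the same
  winding number around all the others.\<close>

lemma homologous_earring_loops:
  assumes E: "E \<subseteq> {p. prime p \<and> odd p}" and E': "E' \<subseteq> {p. prime p \<and> odd p}"
    and hom: "homologous_rel 1 chabauty_R_Z {} (frag_of (loop_simplex (earring_loop E)))
      (frag_of (loop_simplex (earring_loop E')))"
  shows "finite ((E - E') \<union> (E' - E))"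
proof -
  let ?\<sigma> = "\<lambda>E. frag_of (loop_simplex (earring_loop E))"
  obtain d where d: "singular_chain 2 chabauty_R_Z d" "chain_boundary 2 d = ?\<sigma> E - ?\<sigma> E'"
    using hom unfolding homologous_rel_def singular_boundary by (auto simp: numeral_2_eq_2)
  let ?Q = "{0..1} \<times> {0..1} :: (real \<times> real) set"
  let ?bad = "\<lambda>\<tau>. {p. prime p \<and> (\<tau> \<circ> square_to_simplex) ` ?Q \<inter> puncture p \<noteq> {}}"
  have simplex: "singular_simplex 2 chabauty_R_Z \<tau>" if "\<tau> \<in> Poly_Mapping.keys d" for \<tau>
    using d(1) that by (auto simp: singular_chain_def)
  have "finite (?bad \<tau>)" if "\<tau> \<in> Poly_Mapping.keys d" for \<tau>
    using simplex[OF that] unfolding singular_simplex_def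
    by (intro finite_punctures continuous_map_compose[OF continuous_square_to_simplex]
        compact_Times convex_Times) auto
  then have "finite (\<Union>\<tau>\<in>Poly_Mapping.keys d. ?bad \<tau>)" by simp
  moreover have "p \<in> (\<Union>\<tau>\<in>Poly_Mapping.keys d. ?bad \<tau>)" if p: "p \<in> (E - E') \<union> (E' - E)" for p
  proof (rule ccontr)
    assume good: "p \<notin> (\<Union>\<tau>\<in>Poly_Mapping.keys d. ?bad \<tau>)"
    have pp: "prime p" "odd p" using p E E' by auto
    let ?e = "chain_eval (edge_log_change p)"
    have "?e (frag_cmul (Poly_Mapping.lookup d \<tau>)
        (\<Sum>k\<le>2. frag_cmul ((-1) ^ k) (frag_of (singular_face 2 k \<tau>)))) = 0"
      if "\<tau> \<in> Poly_Mapping.keys d" for \<tau>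
      unfolding chain_eval_cmul
      using edge_log_change_boundary[OF simplex[OF that] _ pp(2)] good that pp(1) by auto
    then have "?e (chain_boundary 2 d) = 0"
      unfolding chain_boundary_def frag_extend_def by (simp add: chain_eval_sum)
    then have "edge_log_change p (loop_simplex (earring_loop E)) =
        edge_log_change p (loop_simplex (earring_loop E'))"
      by (simp add: d(2) chain_eval_diff)
    moreover have "edge_log_change p (loop_simplex (earring_loop A)) = (if p \<in> A then 2 * of_real pi * \<i> else 0)"
      if "A \<subseteq> {p. prime p \<and> odd p}" for A
    proof -
      have "edge_log_change p (loop_simplex (earring_loop A)) =
          log_change (\<lambda>s. winding_fun p (earring_loop A s))"
        unfolding edge_log_change_def
        by (intro log_change_cong) (simp add: loop_simplex_def edge_in_simplex[unfolded One_nat_def], simp add: edge_def)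
      then show ?thesis using log_change_earring[OF that pp] by simp
    qed
    ultimately show False using E E' p by (auto split: if_splits)
  qed
  ultimately show ?thesis by (meson finite_subset subsetI)
qed

section \<open>The fundamental group\<close>

text \<open>The loop \<open>c\<close> at the end of \<open>\<gamma>\<close> is carried back to the starting point of \<open>\<gamma>\<close>.\<close>

definition loop_via :: "(real \<Rightarrow> 'a) \<Rightarrow> (real \<Rightarrow> 'a) \<Rightarrow> real \<Rightarrow> 'a"
  where "loop_via \<gamma> c s = (if s \<le> 1/3 then \<gamma> (3 * s) else if s \<le> 2/3 then c (3 * s - 1) else \<gamma> (3 - 3 * s))"

lemma loop_via_loop:
  assumes \<gamma>: "pathin X \<gamma>" and c: "pathin X c" and ends: "c 0 = \<gamma> 1" "c 1 = \<gamma> 1"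
  shows "loop_via \<gamma> c \<in> loops_at X (\<gamma> 0)"
proof -
  have reparam: "continuous_map (top_of_set S) X (\<lambda>s. f (a * s + b))"
    if "pathin X f" "\<And>s. s \<in> S \<Longrightarrow> a * s + b \<in> {0..1}" for f and S :: "real set" and a b
  proof -
    have "continuous_map (top_of_set S) (top_of_set {0..1}) (\<lambda>s. a * s + b)"
      using that(2) by (auto simp: continuous_map_in_subtopology intro!: continuous_intros)
    then have "continuous_map (top_of_set S) X (f \<circ> (\<lambda>s. a * s + b))"
      using that(1) unfolding pathin_def by (rule continuous_map_compose)
    then show ?thesis by (simp add: o_def)
  qed
  have parts: "continuous_map (top_of_set {0..1/3}) X (\<lambda>s. \<gamma> (3 * s))"
    "continuous_map (top_of_set {1/3..2/3}) X (\<lambda>s. c (3 * s - 1))"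
    "continuous_map (top_of_set {2/3..1}) X (\<lambda>s. \<gamma> (3 - 3 * s))"
    using reparam[OF \<gamma>, of "{0..1/3}" 3 0] reparam[OF c, of "{1/3..2/3}" 3 "- 1"]
      reparam[OF \<gamma>, of "{2/3..1}" "- 3" 3] by simp_all
  let ?I = "top_of_set {0..1 :: real}"
  let ?T = "subtopology ?I {x \<in> topspace ?I. 1/3 \<le> x}"
  have "continuous_map ?I X (loop_via \<gamma> c)"
    unfolding loop_via_def[abs_def]
  proof (rule continuous_map_cases_le)
    show "continuous_map ?T X (\<lambda>s. if s \<le> 2/3 then c (3 * s - 1) else \<gamma> (3 - 3 * s))"
    proof (rule continuous_map_cases_le)
      show "continuous_map (subtopology ?T {x \<in> topspace ?T. x \<le> 2/3}) X (\<lambda>s. c (3 * s - 1))"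
        unfolding subtopology_subtopology
        by (rule continuous_map_from_subtopology_mono[OF parts(2)]) auto
      show "continuous_map (subtopology ?T {x \<in> topspace ?T. 2/3 \<le> x}) X (\<lambda>s. \<gamma> (3 - 3 * s))"
        unfolding subtopology_subtopology
        by (rule continuous_map_from_subtopology_mono[OF parts(3)]) auto
      show "c (3 * s - 1) = \<gamma> (3 - 3 * s)" if "s = 2/3" for s
        using ends by (simp add: that)
    qed (auto intro!: continuous_map_from_subtopology)
    show "continuous_map (subtopology ?I {x \<in> topspace ?I. x \<le> 1/3}) X (\<lambda>s. \<gamma> (3 * s))"
      unfolding subtopology_subtopology
      by (rule continuous_map_from_subtopology_mono[OF parts(1)]) auto
    show "\<gamma> (3 * s) = (if s \<le> 2/3 then c (3 * s - 1) else \<gamma> (3 - 3 * s))" if "s = 1/3" for s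
      using ends by (simp add: that)
  qed (auto intro!: continuous_map_from_subtopology)
  then show ?thesis
    by (simp add: loops_at_def pathin_def) (simp add: loop_via_def)
qed

text \<open>As for homology, the homotopy misses almost all punctures. The connecting path may itself pass
  through finitely many punctures, which are then among those reached by the homotopy.\<close>

lemma homotopic_earring_loops:
  assumes E: "E \<subseteq> {p. prime p \<and> odd p}" and E': "E' \<subseteq> {p. prime p \<and> odd p}"
    and hom: "(loop_via \<gamma> (earring_loop E), loop_via \<gamma> (earring_loop E')) \<in> loop_homotopy chabauty_R_Z a"
    and fin: "\<gamma> 1 = {(0, 0)}"
  shows "finite ((E - E') \<union> (E' - E))"
proof -
  let ?Q = "{0..1} \<times> {0..1} :: (real \<times> real) set"
  let ?l = "\<lambda>E. loop_via \<gamma> (earring_loop E)"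
  obtain K where K: "continuous_map (top_of_set ?Q) chabauty_R_Z K"
    and K0: "\<And>s. s \<in> {0..1} \<Longrightarrow> K (0, s) = ?l E s" and K1: "\<And>s. s \<in> {0..1} \<Longrightarrow> K (1, s) = ?l E' s"
    and Ka: "\<And>t. t \<in> {0..1} \<Longrightarrow> K (t, 0) = a" "\<And>t. t \<in> {0..1} \<Longrightarrow> K (t, 1) = a"
  proof -
    have "homotopic_with (\<lambda>r. r 0 = a \<and> r 1 = a) (top_of_set {0..1}) chabauty_R_Z (?l E) (?l E')"
      using hom by (simp add: loop_homotopy_def)
    then show ?thesis
      using that unfolding homotopic_with_def prod_topology_subtopology_eu by blast
  qed
  have "finite {p. prime p \<and> K ` ?Q \<inter> puncture p \<noteq> {}}" (is "finite ?bad")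
    by (intro finite_punctures K compact_Times convex_Times) auto
  moreover have "p \<in> ?bad" if p: "p \<in> (E - E') \<union> (E' - E)" for p
  proof (rule ccontr)
    assume "p \<notin> ?bad"
    have pp: "prime p" "odd p" using p E E' by auto
    then have avoid: "K ` ?Q \<inter> puncture p = {}" using \<open>p \<notin> ?bad\<close> by auto
    obtain L where L: "continuous_on ?Q L"
      "\<And>g. continuous_on {0..1} g \<Longrightarrow> g ` {0..1} \<subseteq> ?Q \<Longrightarrow>
        log_change (\<lambda>s. winding_fun p (K (g s))) = L (g 1) - L (g 0)"
      by (rule log_on_square[OF K avoid pp(2)]) blast
    \<comment> \<open>The two passages through the connecting path cancel.\<close>
    have middle: "L (t, 1) - L (t, 0) = log_change (\<lambda>s. winding_fun p (earring_loop A s))"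
      if t: "t \<in> {0..1}" and A: "\<And>s. s \<in> {0..1} \<Longrightarrow> K (t, s) = ?l A s"
        and ends: "earring_loop A 0 = {(0, 0)}" "earring_loop A 1 = {(0, 0)}" for t A
    proof -
      have part: "log_change (\<lambda>s. winding_fun p (?l A (u * s + v))) = L (t, u + v) - L (t, v)"
        if uv: "\<And>s. s \<in> {0..1} \<Longrightarrow> u * s + v \<in> {0..1}" for u v
      proof -
        have "log_change (\<lambda>s. winding_fun p (?l A (u * s + v))) =
            log_change (\<lambda>s. winding_fun p (K (t, u * s + v)))"
          using uv by (intro log_change_cong) (simp add: A)
        also have "\<dots> = L (t, u * 1 + v) - L (t, u * 0 + v)"
        proof (rule L(2))
          show "(\<lambda>s. (t, u * s + v)) ` {0..1} \<subseteq> ?Q" using t uv by blast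
        qed (intro continuous_intros)
        finally show ?thesis by (simp only: mult_1_right mult_zero_right add_0_left)
      qed
      have "L (t, 1/3) - L (t, 0) = log_change (\<lambda>s. winding_fun p (\<gamma> s))"
      proof -
        have "log_change (\<lambda>s. winding_fun p (?l A (1/3 * s + 0))) = log_change (\<lambda>s. winding_fun p (\<gamma> s))"
          by (rule log_change_cong) (simp add: loop_via_def)
        then show ?thesis using part[of "1/3" 0] by simp
      qed
      moreover have "L (t, 2/3) - L (t, 1) = log_change (\<lambda>s. winding_fun p (\<gamma> s))"
      proof -
        have "log_change (\<lambda>s. winding_fun p (?l A (-1/3 * s + 1))) = log_change (\<lambda>s. winding_fun p (\<gamma> s))"
          by (rule log_change_cong) (auto simp: loop_via_def ends fin)
        then show ?thesis using part[of "-1/3" 1] by simp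
      qed
      moreover have "L (t, 2/3) - L (t, 1/3) = log_change (\<lambda>s. winding_fun p (earring_loop A s))"
      proof -
        have "log_change (\<lambda>s. winding_fun p (?l A (1/3 * s + 1/3))) =
            log_change (\<lambda>s. winding_fun p (earring_loop A s))"
          by (rule log_change_cong) (auto simp: loop_via_def ends fin)
        then show ?thesis using part[of "1/3" "1/3"] by simp
      qed
      ultimately show ?thesis by (simp add: algebra_simps)
    qed
    have side: "L (1, v) = L (0, v)" if "v = 0 \<or> v = 1" for v
    proof -
      have "log_change (\<lambda>s. winding_fun p (K (s, v))) = log_change (\<lambda>_. winding_fun p a)"
        using that Ka by (intro log_change_cong) auto
      moreover have "log_change (\<lambda>s. winding_fun p (K (s, v))) = L (1, v) - L (0, v)"
        using that by (intro L(2)) (auto intro!: continuous_intros)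
      ultimately show ?thesis using log_change_const[OF winding_fun_nonzero, of p a] by simp
    qed
    have ends: "earring_loop A 0 = {(0, 0)}" "earring_loop A 1 = {(0, 0)}"
      if "A \<subseteq> {p. prime p \<and> odd p}" for A
      using that by (auto intro!: earring_loop_ends prime_gt_1_nat simp only:)
    have "log_change (\<lambda>s. winding_fun p (earring_loop E s)) = log_change (\<lambda>s. winding_fun p (earring_loop E' s))"
      using middle[OF _ K0 ends[OF E]] middle[OF _ K1 ends[OF E']] side by simp
    then show False
      using p log_change_earring[OF E pp] log_change_earring[OF E' pp] by (auto split: if_splits)
  qed
  ultimately show ?thesis by (meson finite_subset subsetI)
qed

section \<open>Uncountability\<close>

text \<open>Spreading each element of a set of natural numbers over infinitely many elements of \<open>P\<close> turns
  distinct sets into sets with an infinite symmetric difference.\<close>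

lemma uncountable_if_finite_sym_diff:
  assumes P: "infinite P" and f: "\<And>E. E \<subseteq> P \<Longrightarrow> f E \<in> C"
    and eq: "\<And>E E'. E \<subseteq> P \<Longrightarrow> E' \<subseteq> P \<Longrightarrow> f E = f E' \<Longrightarrow> finite ((E - E') \<union> (E' - E))"
  shows "uncountable C"
proof
  assume "countable C"
  obtain e :: "nat \<Rightarrow> _" where e: "inj e" "range e \<subseteq> P"
    using infinite_countable_subset[OF P] by blast
  define F where "F A = e ` {prod_encode (i, j) | i j. i \<in> A}" for A
  have FP: "F A \<subseteq> P" for A using e(2) by (auto simp: F_def)
  have sub: "A \<subseteq> B" if "f (F A) = f (F B)" for A B
  proof
    fix i assume "i \<in> A"
    show "i \<in> B"
    proof (rule ccontr)
      assume "i \<notin> B"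
      have "range (\<lambda>j. e (prod_encode (i, j))) \<subseteq> F A - F B"
        using \<open>i \<in> A\<close> \<open>i \<notin> B\<close> by (auto simp: F_def inj_eq[OF e(1)])
      moreover have "finite (F A - F B)"
        using eq[OF FP FP that] by simp
      moreover have "inj (\<lambda>j. e (prod_encode (i, j)))"
        by (auto intro!: injI simp: inj_eq[OF e(1)])
      ultimately show False
        using finite_subset range_inj_infinite by blast
    qed
  qed
  have "inj (\<lambda>A. f (F A))"
    by (rule injI) (metis sub subset_antisym)
  moreover have "range (\<lambda>A. f (F A)) \<subseteq> C"
    using f FP by blast
  ultimately have "countable (UNIV :: nat set set)"
    using \<open>countable C\<close> by (metis countable_subset countable_image_inj_on)
  then obtain g :: "nat set \<Rightarrow> nat" where "inj g"
    unfolding countable_def by blast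
  then have "surj (inv_into UNIV g)"
    by (rule inj_imp_surj_inv)
  then show False
    using Cantors_theorem[of "UNIV :: nat set"] by (metis Pow_UNIV)
qed

theorem mainTheorem2:
  shows "uncountable (carrier (homology_group 1 chabauty_R_Z)) \<and>
    (\<forall>H \<in> topspace chabauty_R_Z. uncountable (carrier (fundamental_group chabauty_R_Z H)))"
proof
  let ?P = "{p :: nat. prime p \<and> odd p}"
  have "p \<in> insert 2 ?P" if "prime p" for p :: nat
    using prime_odd_nat[OF that] prime_ge_2_nat[OF that] that by (cases "p = 2") auto
  then have "{p. prime p} \<subseteq> insert 2 ?P" by blast
  then have P: "infinite ?P"
    using primes_infinite by (metis finite_insert finite_subset)
  have c: "continuous_map (top_of_set {0..1}) chabauty_R_Z (earring_loop E)"
    "earring_loop E 0 = {(0, 0)}" "earring_loop E 1 = {(0, 0)}" if "E \<subseteq> ?P" for E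
  proof -
    have gt: "p > 1" if "p \<in> E" for p
      using that \<open>E \<subseteq> ?P\<close> prime_gt_1_nat by blast
    then have "p > 0" if "p \<in> E" for p
      using that less_trans[OF zero_less_one] by blast
    then show "continuous_map (top_of_set {0..1}) chabauty_R_Z (earring_loop E)"
      by (rule continuous_earring_loop)
    show "earring_loop E 0 = {(0, 0)}" "earring_loop E 1 = {(0, 0)}"
      by (rule earring_loop_ends, rule gt, assumption)+
  qed
  show "uncountable (carrier (homology_group 1 chabauty_R_Z))"
  proof (rule uncountable_if_finite_sym_diff[OF P])
    let ?f = "\<lambda>E. homologous_rel_set 1 chabauty_R_Z {} (frag_of (loop_simplex (earring_loop E)))"
    show "?f E \<in> carrier (homology_group 1 chabauty_R_Z)" if "E \<subseteq> ?P" for E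
      using loop_simplex_cycle[OF c(1)[OF that]] c(2,3)[OF that]
        carrier_relative_homology_group[of 1 chabauty_R_Z "{}"] by simp
    show "finite ((E - E') \<union> (E' - E))" if "E \<subseteq> ?P" "E' \<subseteq> ?P" "?f E = ?f E'" for E E'
      using that by (intro homologous_earring_loops) (simp_all only: homologous_rel_set_eq)
  qed
  show "\<forall>H \<in> topspace chabauty_R_Z. uncountable (carrier (fundamental_group chabauty_R_Z H))"
  proof
    fix H assume "H \<in> topspace chabauty_R_Z"
    then obtain \<gamma> where \<gamma>: "pathin chabauty_R_Z \<gamma>" "\<gamma> 0 = H" "\<gamma> 1 = {(0, 0)}"
      using path_to_trivial unfolding path_component_of_def by blast
    let ?l = "\<lambda>E. loop_via \<gamma> (earring_loop E)"
    have l: "?l E \<in> loops_at chabauty_R_Z H" if "E \<subseteq> ?P" for E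
      using loop_via_loop[OF \<gamma>(1), of "earring_loop E"] c[OF that] \<gamma> by (simp add: pathin_def)
    show "uncountable (carrier (fundamental_group chabauty_R_Z H))"
    proof (rule uncountable_if_finite_sym_diff[OF P])
      let ?f = "\<lambda>E. loop_homotopy chabauty_R_Z H `` {?l E}"
      show "?f E \<in> carrier (fundamental_group chabauty_R_Z H)" if "E \<subseteq> ?P" for E
        using quotientI[OF l[OF that]] by (simp add: fundamental_group_def)
      show "finite ((E - E') \<union> (E' - E))" if "E \<subseteq> ?P" "E' \<subseteq> ?P" "?f E = ?f E'" for E E'
        using eq_equiv_class[OF that(3) equiv_loop_homotopy l[OF that(2)]] that(1,2) \<gamma>(3)
        by (intro homotopic_earring_loops)
    qed
  qed
qed

end
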